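(* If there is a deterministic (respectively, randomized) polynomial time algorithm for the weighted exact matching problem in bipartite graphs, then there is a deterministic (respectively, randomized) polynomial time algorithm for BM'.
   Context: The $2$-covariate BM problem has the following input: - a finite set $\mathcal{T}$ of $n$ treatment samples and a finite set $\mathcal{C}$ of $n'$ control samples; - two covariates; covariate $p$ ($p=1,2$) has $k_p$ levels and partitions $\mathcal{T}$ into $L_{p,1},\dots,L_{p,k_p}$ with sizes $\ell_{p,i}$, and $\mathcal{C}$ into $L'_{p,1},\dots,L'_{p,k_p}$; - distances $\delta_{tc}$ for $t\in\mathcal{T}$, $c\in\mathcal{C}$. The task is to find an injective map $m:\mathcal{T}\to\mathcal{C}$ whose image $S'$ satisfies $|S'\cap L'_{p,i}|=\ell_{p,i}$ for all $p$ and $i$, minimizing $\sum_t\delta_{t,m(t)}$, or to report infeasibility. BM' denotes the special case in which: - the second covariate has a constant number $k_2$ of levels, while the first covariate is unrestricted; - the distances are nonnegative integers bounded by a polynomial $\pi$ of the input encoding length. The weighted exact matching problem in bipartite graphs has as input a bipartite graph $G=(V,E)$, nonnegative integer edge weights $\delta_e$ bounded by a polynomial in $|V|+|E|$, and a target $K$. It asks for a perfect matching of total weight exactly $K$. *)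

theory Defs
  imports
    "HOL-Probability.Probability_Mass_Function"
    "HOL-Computational_Algebra.Polynomial"
    "HOL-Library.Log_Nat"
begin

section \<open>The model of computation\<close>

text \<open>
  Algorithms are WHILE programs over binary trees whose leaves are natural numbers. Every value that
  is read, built or copied is charged its size, numbers being charged their binary length
  (logarithmic cost criterion). Since all primitive operations are computable by a Turing machine
  in time polynomial in the sizes charged, and a Turing machine step can be simulated at
  a cost polynomial in the length of the tape content, polynomial cost in this model is
  polynomial time in the usual sense.
\<close>

datatype val = Num nat | Node val val

primrec vsize :: "val \<Rightarrow> nat" where
  "vsize (Num n) = 1 + nat (bitlen (int n))"
| "vsize (Node a b) = 1 + vsize a + vsize b"

primrec num_of :: "val \<Rightarrow> nat" where
  "num_of (Num n) = n"
| "num_of (Node a b) = 0"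

primrec left :: "val \<Rightarrow> val" where
  "left (Num n) = Num 0"
| "left (Node a b) = a"

primrec right :: "val \<Rightarrow> val" where
  "right (Num n) = Num 0"
| "right (Node a b) = b"

primrec is_node :: "val \<Rightarrow> bool" where
  "is_node (Num n) = False"
| "is_node (Node a b) = True"

definition of_truth :: "bool \<Rightarrow> val" where
  "of_truth b = Num (if b then 1 else 0)"

definition truth :: "val \<Rightarrow> bool" where
  "truth v \<longleftrightarrow> v \<noteq> Num 0"

type_synonym var = nat
type_synonym state = "var \<Rightarrow> val"

datatype expr =
    Var var
  | Const nat
  | MkNode expr expr
  | Left expr
  | Right expr
  | IsNode expr
  | Add expr expr
  | Sub expr expr
  | Mul expr expr
  | Less expr expr
  | Equal expr expr

primrec eval :: "state \<Rightarrow> expr \<Rightarrow> val" where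
  "eval s (Var x) = s x"
| "eval s (Const n) = Num n"
| "eval s (MkNode a b) = Node (eval s a) (eval s b)"
| "eval s (Left a) = left (eval s a)"
| "eval s (Right a) = right (eval s a)"
| "eval s (IsNode a) = of_truth (is_node (eval s a))"
| "eval s (Add a b) = Num (num_of (eval s a) + num_of (eval s b))"
| "eval s (Sub a b) = Num (num_of (eval s a) - num_of (eval s b))"
| "eval s (Mul a b) = Num (num_of (eval s a) * num_of (eval s b))"
| "eval s (Less a b) = of_truth (num_of (eval s a) < num_of (eval s b))"
| "eval s (Equal a b) = of_truth (eval s a = eval s b)"

text \<open>The cost of an expression: one plus the size of the value, summed over all subexpressions.\<close>

primrec cost :: "state \<Rightarrow> expr \<Rightarrow> nat" where
  "cost s (Var x) = 1 + vsize (eval s (Var x))"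
| "cost s (Const n) = 1 + vsize (eval s (Const n))"
| "cost s (MkNode a b) = 1 + vsize (eval s (MkNode a b)) + cost s a + cost s b"
| "cost s (Left a) = 1 + vsize (eval s (Left a)) + cost s a"
| "cost s (Right a) = 1 + vsize (eval s (Right a)) + cost s a"
| "cost s (IsNode a) = 1 + vsize (eval s (IsNode a)) + cost s a"
| "cost s (Add a b) = 1 + vsize (eval s (Add a b)) + cost s a + cost s b"
| "cost s (Sub a b) = 1 + vsize (eval s (Sub a b)) + cost s a + cost s b"
| "cost s (Mul a b) = 1 + vsize (eval s (Mul a b)) + cost s a + cost s b"
| "cost s (Less a b) = 1 + vsize (eval s (Less a b)) + cost s a + cost s b"
| "cost s (Equal a b) = 1 + vsize (eval s (Equal a b)) + cost s a + cost s b"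

text \<open>
  \<open>Flip x\<close> tosses a fair coin. \<open>Call x c e\<close> runs the closed (hence non-recursive)
  procedure body \<open>c\<close> on a fresh store with input \<open>e\<close> and stores its output in \<open>x\<close>.
\<close>

datatype com =
    Assign var expr
  | Flip var
  | Call var com expr
  | Seq com com
  | Cond expr com com
  | While expr com

primrec flip_free :: "com \<Rightarrow> bool" where
  "flip_free (Assign x e) \<longleftrightarrow> True"
| "flip_free (Flip x) \<longleftrightarrow> False"
| "flip_free (Call x c e) \<longleftrightarrow> flip_free c"
| "flip_free (Seq c d) \<longleftrightarrow> flip_free c \<and> flip_free d"
| "flip_free (Cond e c d) \<longleftrightarrow> flip_free c \<and> flip_free d"
| "flip_free (While e c) \<longleftrightarrow> flip_free c"

text \<open>Programs take their input from, and leave their output in, variable 0.\<close>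

definition init :: "val \<Rightarrow> state" where
  "init v = (\<lambda>_. Num 0)(0 := v)"

definition tick :: "nat \<Rightarrow> (state \<times> nat) pmf \<Rightarrow> (state \<times> nat) pmf" where
  "tick n \<mu> = map_pmf (\<lambda>(s, t). (s, n + t)) \<mu>"

text \<open>
  \<open>exec c s \<mu>\<close>: started in store \<open>s\<close>, the program \<open>c\<close> halts for all outcomes of its coin tosses, and
  \<open>\<mu>\<close> is the joint distribution of the final store and the time used. In the rules for \<open>Seq\<close> and \<open>While\<close>,
  \<open>\<nu> s'\<close> is the distribution obtained by continuing from the intermediate store \<open>s'\<close>.
\<close>

inductive exec :: "com \<Rightarrow> state \<Rightarrow> (state \<times> nat) pmf \<Rightarrow> bool" where
  Assign: "exec (Assign x e) s (return_pmf (s(x := eval s e), 1 + cost s e))"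
| Flip: "exec (Flip x) s (map_pmf (\<lambda>b. (s(x := of_truth b), 1)) (bernoulli_pmf (1 / 2)))"
| Call: "exec c (init (eval s e)) \<mu> \<Longrightarrow>
    exec (Call x c e) s
      (map_pmf (\<lambda>(s', t). (s(x := s' 0), 1 + cost s e + t + vsize (s' 0))) \<mu>)"
| Seq: "exec c s \<mu> \<Longrightarrow> (\<And>s' t. (s', t) \<in> set_pmf \<mu> \<Longrightarrow> exec d s' (\<nu> s')) \<Longrightarrow>
    exec (Seq c d) s (bind_pmf \<mu> (\<lambda>(s', t). tick t (\<nu> s')))"
| CondTrue: "truth (eval s e) \<Longrightarrow> exec c s \<mu> \<Longrightarrow> exec (Cond e c d) s (tick (1 + cost s e) \<mu>)"
| CondFalse: "\<not> truth (eval s e) \<Longrightarrow> exec d s \<mu> \<Longrightarrow> exec (Cond e c d) s (tick (1 + cost s e) \<mu>)"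
| WhileTrue: "truth (eval s e) \<Longrightarrow> exec c s \<mu> \<Longrightarrow>
    (\<And>s' t. (s', t) \<in> set_pmf \<mu> \<Longrightarrow> exec (While e c) s' (\<nu> s')) \<Longrightarrow>
    exec (While e c) s (tick (1 + cost s e) (bind_pmf \<mu> (\<lambda>(s', t). tick t (\<nu> s'))))"
| WhileFalse: "\<not> truth (eval s e) \<Longrightarrow>
    exec (While e c) s (return_pmf (s, 1 + cost s e))"

definition runs :: "com \<Rightarrow> val \<Rightarrow> (val \<times> nat) pmf \<Rightarrow> bool" where
  "runs c x \<rho> \<longleftrightarrow> (\<exists>\<mu>. exec c (init x) \<mu> \<and> \<rho> = map_pmf (\<lambda>(s, t). (s 0, t)) \<mu>)"

lemma exec_unique: "exec c s \<mu> \<Longrightarrow> exec c s \<mu>' \<Longrightarrow> \<mu>' = \<mu>"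
proof (induction arbitrary: \<mu>' rule: exec.induct)
  case (Seq c s \<mu> d \<nu>)
  from Seq.prems obtain \<mu>1 \<nu>1 where 1: "exec c s \<mu>1"
    "\<And>s' t. (s', t) \<in> set_pmf \<mu>1 \<Longrightarrow> exec d s' (\<nu>1 s')"
    "\<mu>' = bind_pmf \<mu>1 (\<lambda>(s', t). tick t (\<nu>1 s'))"
    by (cases rule: exec.cases) auto
  with Seq.IH(1) have [simp]: "\<mu>1 = \<mu>" by blast
  have "\<nu>1 s' = \<nu> s'" if "(s', t) \<in> set_pmf \<mu>" for s' t
    using 1(2)[of s' t] Seq.IH(2)[of s' t] that by simp
  then show ?case unfolding 1(3) by (auto intro!: bind_pmf_cong)
next
  case (WhileTrue s e c \<mu> \<nu>)
  from WhileTrue.prems WhileTrue.hyps obtain \<mu>1 \<nu>1 where 1: "exec c s \<mu>1"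
    "\<And>s' t. (s', t) \<in> set_pmf \<mu>1 \<Longrightarrow> exec (While e c) s' (\<nu>1 s')"
    "\<mu>' = tick (1 + cost s e) (bind_pmf \<mu>1 (\<lambda>(s', t). tick t (\<nu>1 s')))"
    by (cases rule: exec.cases) auto
  with WhileTrue.IH(1) have [simp]: "\<mu>1 = \<mu>" by blast
  have "\<nu>1 s' = \<nu> s'" if "(s', t) \<in> set_pmf \<mu>" for s' t
    using 1(2)[of s' t] WhileTrue.IH(2)[of s' t] that by simp
  then have "bind_pmf \<mu>1 (\<lambda>(s', t). tick t (\<nu>1 s')) = bind_pmf \<mu> (\<lambda>(s', t). tick t (\<nu> s'))"
    by (auto intro!: bind_pmf_cong)
  then show ?case unfolding 1(3) by simp
next
  case (Call c s e \<mu> x)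
  from Call.prems show ?case by (cases rule: exec.cases) (auto dest: Call.IH)
next
  case (CondTrue s e c \<mu> d)
  from CondTrue.prems CondTrue.hyps show ?case by (cases rule: exec.cases) (auto dest: CondTrue.IH)
next
  case (CondFalse s e d \<mu> c)
  from CondFalse.prems CondFalse.hyps show ?case by (cases rule: exec.cases) (auto dest: CondFalse.IH)
qed (auto elim: exec.cases)

section \<open>Polynomial time algorithms for search problems\<close>

text \<open>
  A search problem is given by the pairs of an encoded instance and the set of the encodings of the
  correct answers for that instance. The length of an encoded instance is its size.
\<close>

type_synonym problem = "(val \<times> val set) set"

definition det_poly_time :: "problem \<Rightarrow> bool" where
  "det_poly_time P \<longleftrightarrow>
    (\<exists>c p. flip_free c \<and>
      (\<forall>(x, Y) \<in> P. \<exists>y t. runs c x (return_pmf (y, t)) \<and> t \<le> poly p (vsize x) \<and> y \<in> Y))"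

text \<open>Bounded error: worst-case polynomial time, and a correct answer with probability at least 2/3.\<close>

definition rand_poly_time :: "problem \<Rightarrow> bool" where
  "rand_poly_time P \<longleftrightarrow>
    (\<exists>c p. \<forall>(x, Y) \<in> P. \<exists>\<rho>. runs c x \<rho> \<and>
      (\<forall>(y, t) \<in> set_pmf \<rho>. t \<le> poly p (vsize x)) \<and>
      measure_pmf.prob \<rho> {(y, t). y \<in> Y} \<ge> 2 / 3)"

section \<open>Encodings\<close>

text \<open>
  A finite set is encoded by any list enumerating it without repetition; \<open>f\<close> maps the
  list entries to the elements they stand for.
\<close>

definition enumerates :: "('b \<Rightarrow> 'a) \<Rightarrow> 'b list \<Rightarrow> 'a set \<Rightarrow> bool" where
  "enumerates f xs A \<longleftrightarrow> distinct (map f xs) \<and> set (map f xs) = A"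

primrec enc_list :: "('a \<Rightarrow> val) \<Rightarrow> 'a list \<Rightarrow> val" where
  "enc_list f [] = Num 0"
| "enc_list f (x # xs) = Node (f x) (enc_list f xs)"

definition enc_pair :: "nat \<times> nat \<Rightarrow> val" where
  "enc_pair = (\<lambda>(a, b). Node (Num a) (Num b))"

definition enc_triple :: "nat \<times> nat \<times> nat \<Rightarrow> val" where
  "enc_triple = (\<lambda>(a, b, c). Node (Num a) (Node (Num b) (Num c)))"

abbreviation enc_none :: val where
  "enc_none \<equiv> Num 0"

abbreviation enc_some :: "val \<Rightarrow> val" where
  "enc_some v \<equiv> Node (Num 1) v"

section \<open>Weighted exact matching in bipartite graphs\<close>

record wem_instance =
  verts :: "nat set"
  edges :: "nat set set"
  weight :: "nat set \<Rightarrow> nat"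
  target :: nat

definition bipartite :: "nat set \<Rightarrow> nat set set \<Rightarrow> bool" where
  "bipartite V E \<longleftrightarrow>
    (\<exists>A B. A \<union> B = V \<and> A \<inter> B = {} \<and> (\<forall>e\<in>E. \<exists>a\<in>A. \<exists>b\<in>B. e = {a, b}))"

definition perfect_matching :: "nat set \<Rightarrow> nat set set \<Rightarrow> nat set set \<Rightarrow> bool" where
  "perfect_matching V E M \<longleftrightarrow> M \<subseteq> E \<and> (\<forall>v\<in>V. \<exists>!e. e \<in> M \<and> v \<in> e)"

definition exact_matching :: "wem_instance \<Rightarrow> nat set set \<Rightarrow> bool" where
  "exact_matching G M \<longleftrightarrow>
    perfect_matching (verts G) (edges G) M \<and> (\<Sum>e\<in>M. weight G e) = target G"

definition endpoints :: "nat \<times> nat \<Rightarrow> nat set" where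
  "endpoints = (\<lambda>(u, v). {u, v})"

definition wem_encodes :: "wem_instance \<Rightarrow> val \<Rightarrow> bool" where
  "wem_encodes G x \<longleftrightarrow> (\<exists>vs es.
    enumerates id vs (verts G) \<and> enumerates endpoints es (edges G) \<and>
    x = Node (enc_list Num vs)
          (Node (enc_list (\<lambda>(u, v). enc_triple (u, v, weight G {u, v})) es)
            (Num (target G))))"

definition wem_answers :: "wem_instance \<Rightarrow> val set" where
  "wem_answers G =
    {enc_some (enc_list enc_pair es) | es M. exact_matching G M \<and> enumerates endpoints es M} \<union>
    {y. y = enc_none \<and> (\<nexists>M. exact_matching G M)}"

text \<open>The problem for the edge weight bound \<open>q\<close>.\<close>

definition WEM :: "nat poly \<Rightarrow> problem" where
  "WEM q = {(x, wem_answers G) | G x.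
    finite (verts G) \<and> bipartite (verts G) (edges G) \<and>
    (\<forall>e\<in>edges G. weight G e \<le> poly q (card (verts G) + card (edges G))) \<and>
    wem_encodes G x}"

section \<open>The 2-covariate BM problem\<close>

text \<open>
  \<open>nlevels p\<close> is the number of levels of covariate \<open>p\<close>; \<open>tlevel p\<close> and \<open>clevel p\<close> give the level
  of a treatment and of a control sample, that is, the index of the part it belongs to.
\<close>

record bm_instance =
  treatments :: "nat set"
  controls :: "nat set"
  nlevels :: "nat \<Rightarrow> nat"
  tlevel :: "nat \<Rightarrow> nat \<Rightarrow> nat"
  clevel :: "nat \<Rightarrow> nat \<Rightarrow> nat"
  distance :: "nat \<Rightarrow> nat \<Rightarrow> nat"

definition tpart :: "bm_instance \<Rightarrow> nat \<Rightarrow> nat \<Rightarrow> nat set" where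
  "tpart I p i = {t \<in> treatments I. tlevel I p t = i}"

definition cpart :: "bm_instance \<Rightarrow> nat \<Rightarrow> nat \<Rightarrow> nat set" where
  "cpart I p i = {c \<in> controls I. clevel I p c = i}"

definition bm_wf :: "bm_instance \<Rightarrow> bool" where
  "bm_wf I \<longleftrightarrow> finite (treatments I) \<and> finite (controls I) \<and>
    (\<forall>p\<in>{1, 2}. treatments I = (\<Union>i\<in>{1..nlevels I p}. tpart I p i) \<and>
      controls I = (\<Union>i\<in>{1..nlevels I p}. cpart I p i))"

definition bm_feasible :: "bm_instance \<Rightarrow> (nat \<Rightarrow> nat) \<Rightarrow> bool" where
  "bm_feasible I m \<longleftrightarrow> inj_on m (treatments I) \<and> m ` treatments I \<subseteq> controls I \<and>
    (\<forall>p\<in>{1, 2}. \<forall>i\<in>{1..nlevels I p}.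
      card (m ` treatments I \<inter> cpart I p i) = card (tpart I p i))"

definition bm_cost :: "bm_instance \<Rightarrow> (nat \<Rightarrow> nat) \<Rightarrow> nat" where
  "bm_cost I m = (\<Sum>t\<in>treatments I. distance I t (m t))"

definition bm_optimal :: "bm_instance \<Rightarrow> (nat \<Rightarrow> nat) \<Rightarrow> bool" where
  "bm_optimal I m \<longleftrightarrow> bm_feasible I m \<and> (\<forall>m'. bm_feasible I m' \<longrightarrow> bm_cost I m \<le> bm_cost I m')"

text \<open>Each sample is listed with its two levels; the distances form a matrix, listed row by row.\<close>

definition bm_encodes :: "bm_instance \<Rightarrow> val \<Rightarrow> bool" where
  "bm_encodes I x \<longleftrightarrow> (\<exists>ts cs.
    enumerates id ts (treatments I) \<and> enumerates id cs (controls I) \<and>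
    x = Node (enc_pair (nlevels I 1, nlevels I 2))
          (Node (enc_list (\<lambda>t. enc_triple (t, tlevel I 1 t, tlevel I 2 t)) ts)
            (Node (enc_list (\<lambda>c. enc_triple (c, clevel I 1 c, clevel I 2 c)) cs)
              (enc_list (\<lambda>t. enc_list (\<lambda>c. Num (distance I t c)) cs) ts))))"

definition bm_answers :: "bm_instance \<Rightarrow> val set" where
  "bm_answers I =
    {enc_some (enc_list (\<lambda>t. enc_pair (t, m t)) ts) | ts m.
       bm_optimal I m \<and> enumerates id ts (treatments I)} \<union>
    {y. y = enc_none \<and> (\<nexists>m. bm_feasible I m)}"

text \<open>The special case of BM for the constant \<open>k2\<close> and the distance bound \<open>\<pi>\<close>.\<close>

definition BM' :: "nat \<Rightarrow> nat poly \<Rightarrow> problem" where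
  "BM' k2 \<pi> = {(x, bm_answers I) | I x.
    bm_wf I \<and> nlevels I 2 = k2 \<and>
    bm_encodes I x \<and>
    (\<forall>t\<in>treatments I. \<forall>c\<in>controls I. distance I t c \<le> poly \<pi> (vsize x))}"

end

theory Submission
  imports Defs
begin

text \<open>
  In a perfect matching of the graph, a treatment \<open>t\<close> is matched with the control \<open>m t\<close>.
  The first covariate is balanced by the graph itself: each control has a copy, each treatment has
  a slot, and the copy of a control can only be matched with a control or with a slot of its own level,
  so that in each level exactly as many controls are left for the treatments as there are slots.
  The second covariate is balanced by the weights: a control of level \<open>j\<close> contributes
  \<open>(N + 1) (n + 1) ^ j\<close> on top of the distance, where \<open>N\<close> is the sum of all
  distances, so that an exact weight fixes both the cost and, as digits in base \<open>n + 1\<close>, the number of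
  controls of each level. These weights are polynomial since \<open>k\<^sub>2\<close> is constant.

  The target weight is tried for every cost \<open>d = N, \<dots>, 0\<close>, and an answer is used only after it has been
  verified; the last verified answer is kept. An unattainable cost never yields a verified answer, so the
  only call that matters is the one for the optimal cost, and no error amplification is needed. Thus the
  same program serves the deterministic and the randomized case.
\<close>

section \<open>Polynomial time functions\<close>

text \<open>The proof is shaped by what may be assumed of a matching algorithm: it is reliable only
  on encoded instances whose weights are polynomial in the size of the graph, and in the randomized
  case a single answer may be any value at all. Counting the costs downwards is what stops errors
  from accumulating. A wrong outcome at a cost above the optimum is overwritten when the optimum is
  verified, and below the optimum every answer fails verification, so a success at the optimum is
  final. The probability 2/3 of that one call is therefore the probability of the whole search. The
  factor \<open>N + 1\<close> comes from the fact that every map into the controls costs at most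
  \<open>N\<close>: the remainder of the weight modulo \<open>N + 1\<close> is the cost, and the
  quotient is the sum of powers of \<open>n + 1\<close>, in which no carries occur because a level
  receives at most \<open>n\<close> controls. One list \<open>N, ..., 0\<close> has two roles: it
  indexes the padding edges of the graph, and it lists the costs to be tried.\<close>

definition poly_bounded :: "(nat \<Rightarrow> nat) \<Rightarrow> bool" where
  "poly_bounded T \<longleftrightarrow> (\<exists>p. \<forall>n. T n \<le> poly p n)"

lemma poly_nat_mono:
  fixes p :: "nat poly"
  assumes "m \<le> n"
  shows "poly p m \<le> poly p n"
  by (induction p) (use assms in \<open>auto intro!: add_mono mult_mono\<close>)

lemma poly_bounded_const: "poly_bounded (\<lambda>n. k)"
  unfolding poly_bounded_def by (rule exI[of _ "[:k:]"]) simp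

lemma poly_bounded_id: "poly_bounded (\<lambda>n. n)"
  unfolding poly_bounded_def by (rule exI[of _ "[:0, 1:]"]) simp

lemma poly_bounded_add: "poly_bounded S \<Longrightarrow> poly_bounded T \<Longrightarrow> poly_bounded (\<lambda>n. S n + T n)"
  unfolding poly_bounded_def by (metis add_mono poly_add)

lemma poly_bounded_mult: "poly_bounded S \<Longrightarrow> poly_bounded T \<Longrightarrow> poly_bounded (\<lambda>n. S n * T n)"
  unfolding poly_bounded_def by (metis mult_le_mono poly_mult)

lemma poly_bounded_poly: "poly_bounded T \<Longrightarrow> poly_bounded (\<lambda>n. poly p (T n))"
  unfolding poly_bounded_def by (metis poly_nat_mono poly_pcompose)

lemmas poly_bounded_intros =
  poly_bounded_const poly_bounded_id poly_bounded_add poly_bounded_mult poly_bounded_poly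

section \<open>Sizes of numbers and values\<close>

lemma bitlen_le_iff: "nat (bitlen (int n)) \<le> k \<longleftrightarrow> n < 2 ^ k"
proof -
  have "nat (bitlen (int n)) \<le> k \<longleftrightarrow> bitlen (int n) \<le> int k" by linarith
  also have "\<dots> \<longleftrightarrow> int n < 2 ^ k" using bitlen_le_iff_power[of "int n" k] by simp
  also have "\<dots> \<longleftrightarrow> int n < int (2 ^ k)" by simp
  also have "\<dots> \<longleftrightarrow> n < 2 ^ k" by (rule of_nat_less_iff)
  finally show ?thesis .
qed

lemma vsize_Num_le: "vsize (Num n) \<le> Suc k \<longleftrightarrow> n < 2 ^ k"
  by (simp add: bitlen_le_iff)

lemma vsize_Num_bound: "vsize (Num n) \<le> n + 1"
  using vsize_Num_le[of n n] by (simp del: vsize.simps)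

lemma vsize_ge_1: "1 \<le> vsize v"
  by (cases v) auto

lemma vsize_Num_num_of: "vsize (Num (num_of v)) \<le> vsize v"
  by (cases v) auto

text \<open>Crude, but in the form that a running sum needs: a summand increases the size by at most
  its own size. The carry bit is paid for by the constant 1 in the second size.\<close>

lemma vsize_add: "vsize (Num (m + n)) \<le> vsize (Num m) + vsize (Num n)"
proof -
  let ?a = "nat (bitlen (int m))" and ?b = "nat (bitlen (int n))"
  have "m < 2 ^ ?a" "n < 2 ^ ?b" using bitlen_le_iff by blast+
  moreover have "(2::nat) ^ ?a \<le> 2 ^ (?a + ?b)" "(2::nat) ^ ?b \<le> 2 ^ (?a + ?b)" by simp_all
  ultimately have "m + n < 2 ^ Suc (?a + ?b)" by (simp only: power_Suc)
  then show ?thesis using vsize_Num_le[of "m + n" "Suc (?a + ?b)"] by simp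
qed

lemma vsize_mult: "vsize (Num (m * n)) \<le> vsize (Num m) + vsize (Num n)"
proof -
  let ?a = "nat (bitlen (int m))" and ?b = "nat (bitlen (int n))"
  have "m < 2 ^ ?a" "n < 2 ^ ?b" using bitlen_le_iff by blast+
  then have "m * n < 2 ^ (?a + ?b)" by (simp add: power_add mult_strict_mono)
  then show ?thesis using vsize_Num_le[of "m * n" "?a + ?b"] by simp
qed

lemma vsize_of_truth: "vsize (of_truth b) \<le> 2"
  using vsize_Num_bound[of 1] by (auto simp: of_truth_def)

lemma vsize_of_truth_le [simp]: "vsize (of_truth b) \<le> Suc (Suc n)"
  using vsize_of_truth[of b] by simp

lemma vsize_left: "vsize (left v) \<le> vsize v"
  by (cases v) auto

lemma vsize_right: "vsize (right v) \<le> vsize v"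
  by (cases v) auto

lemma truth_of_truth [simp]: "truth (of_truth b) \<longleftrightarrow> b"
  by (simp add: truth_def of_truth_def)

lemma vsize_eval_le_cost: "vsize (eval s e) \<le> cost s e"
  by (cases e) auto

text \<open>Every stored value has been paid for when it was built. The factor 2 covers
  \<open>Flip\<close>, which costs 1 and may store a value of size 2.\<close>

lemma exec_vsize:
  assumes "exec c s \<mu>" "(s', t) \<in> set_pmf \<mu>"
  shows "vsize (s' x) \<le> vsize (s x) + 2 * t"
  using assms
proof (induction arbitrary: s' t x rule: exec.induct)
  case (Assign y e s)
  then show ?case using vsize_eval_le_cost[of s e] by auto
next
  case (Flip y s)
  then show ?case by auto
next
  case (Call c s e \<mu> y)
  then show ?case by auto
next
  case (Seq c s \<mu> d \<nu>)
  from Seq.prems obtain s1 t1 t2 where "(s1, t1) \<in> set_pmf \<mu>" "(s', t2) \<in> set_pmf (\<nu> s1)" "t = t1 + t2"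
    by (auto simp: tick_def)
  then show ?case using Seq.IH(1)[of s1 t1 x] Seq.IH(2)[of s1 t1 s' t2 x] by simp
next
  case (CondTrue s e c \<mu> d)
  from CondTrue.prems obtain t1 where "(s', t1) \<in> set_pmf \<mu>" "t = 1 + cost s e + t1"
    by (auto simp: tick_def)
  then show ?case using CondTrue.IH[of s' t1 x] by simp
next
  case (CondFalse s e d \<mu> c)
  from CondFalse.prems obtain t1 where "(s', t1) \<in> set_pmf \<mu>" "t = 1 + cost s e + t1"
    by (auto simp: tick_def)
  then show ?case using CondFalse.IH[of s' t1 x] by simp
next
  case (WhileTrue s e c \<mu> \<nu>)
  from WhileTrue.prems obtain s1 t1 t2 where "(s1, t1) \<in> set_pmf \<mu>" "(s', t2) \<in> set_pmf (\<nu> s1)"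
    "t = 1 + cost s e + (t1 + t2)"
    by (auto simp: tick_def)
  then show ?case using WhileTrue.IH(1)[of s1 t1 x] WhileTrue.IH(2)[of s1 t1 s' t2 x] by simp
next
  case (WhileFalse s e c)
  then show ?case by simp
qed

lemma exec_flip_free:
  assumes "exec c s \<mu>" "flip_free c"
  shows "\<exists>r. \<mu> = return_pmf r"
  using assms
proof (induction rule: exec.induct)
  case (Call c s e \<mu> x)
  then show ?case by (auto simp: map_return_pmf)
next
  case (Seq c s \<mu> d \<nu>)
  then obtain s1 t1 where [simp]: "\<mu> = return_pmf (s1, t1)" by auto
  with Seq obtain r where "\<nu> s1 = return_pmf r" by fastforce
  then show ?case by (auto simp: tick_def bind_return_pmf)
next
  case (CondTrue s e c \<mu> d)
  then show ?case by (auto simp: tick_def)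
next
  case (CondFalse s e d \<mu> c)
  then show ?case by (auto simp: tick_def)
next
  case (WhileTrue s e c \<mu> \<nu>)
  then obtain s1 t1 where [simp]: "\<mu> = return_pmf (s1, t1)" by auto
  with WhileTrue obtain r where "\<nu> s1 = return_pmf r" by fastforce
  then show ?case by (auto simp: tick_def bind_return_pmf)
qed auto

section \<open>Deterministic execution within a time bound\<close>

definition det_exec :: "com \<Rightarrow> state \<Rightarrow> state \<Rightarrow> nat \<Rightarrow> bool" where
  "det_exec c s s' T \<longleftrightarrow> (\<exists>t\<le>T. exec c s (return_pmf (s', t)))"

lemma det_exec_mono: "det_exec c s s' T \<Longrightarrow> T \<le> T' \<Longrightarrow> det_exec c s s' T'"
  unfolding det_exec_def by (meson le_trans)

lemma det_exec_Assign: "det_exec (Assign x e) s (s(x := eval s e)) (1 + cost s e)"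
  unfolding det_exec_def by (blast intro: exec.Assign)

lemma det_exec_Seq:
  assumes "det_exec c s s1 T1" "det_exec d s1 s2 T2"
  shows "det_exec (Seq c d) s s2 (T1 + T2)"
proof -
  from assms obtain t1 t2 where t: "t1 \<le> T1" "t2 \<le> T2"
    "exec c s (return_pmf (s1, t1))" "exec d s1 (return_pmf (s2, t2))"
    unfolding det_exec_def by auto
  have "exec (Seq c d) s (bind_pmf (return_pmf (s1, t1)) (\<lambda>(s', t). tick t (return_pmf (s2, t2))))"
    by (rule exec.Seq[OF t(3)]) (use t(4) in simp)
  then have "exec (Seq c d) s (return_pmf (s2, t1 + t2))"
    by (simp add: tick_def bind_return_pmf)
  then show ?thesis using t(1,2) unfolding det_exec_def by (meson add_mono)
qed

lemma det_exec_WhileTrue: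
  assumes "truth (eval s e)" "det_exec c s s1 T1" "det_exec (While e c) s1 s2 T2"
  shows "det_exec (While e c) s s2 (1 + cost s e + T1 + T2)"
proof -
  from assms obtain t1 t2 where t: "t1 \<le> T1" "t2 \<le> T2"
    "exec c s (return_pmf (s1, t1))" "exec (While e c) s1 (return_pmf (s2, t2))"
    unfolding det_exec_def by auto
  have "exec (While e c) s
    (tick (1 + cost s e) (bind_pmf (return_pmf (s1, t1)) (\<lambda>(s', t). tick t (return_pmf (s2, t2)))))"
    by (rule exec.WhileTrue[OF assms(1) t(3)]) (use t(4) in simp)
  then have "exec (While e c) s (return_pmf (s2, 1 + cost s e + (t1 + t2)))"
    by (simp add: tick_def bind_return_pmf)
  then show ?thesis using t(1,2) unfolding det_exec_def
    by (intro exI[of _ "1 + cost s e + (t1 + t2)"]) simp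
qed

lemma det_exec_WhileFalse:
  "\<not> truth (eval s e) \<Longrightarrow> det_exec (While e c) s s (1 + cost s e)"
  unfolding det_exec_def by (blast intro: exec.WhileFalse)

lemma det_exec_CondTrue:
  assumes "truth (eval s e)" "det_exec c s s' T"
  shows "det_exec (Cond e c d) s s' (1 + cost s e + T)"
proof -
  from assms(2) obtain t where t: "t \<le> T" "exec c s (return_pmf (s', t))"
    unfolding det_exec_def by auto
  show ?thesis unfolding det_exec_def
    by (intro exI[of _ "1 + cost s e + t"])
      (use exec.CondTrue[OF assms(1) t(2), of d] t(1) in \<open>auto simp: tick_def\<close>)
qed

lemma det_exec_CondFalse:
  assumes "\<not> truth (eval s e)" "det_exec d s s' T"
  shows "det_exec (Cond e c d) s s' (1 + cost s e + T)"
proof -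
  from assms(2) obtain t where t: "t \<le> T" "exec d s (return_pmf (s', t))"
    unfolding det_exec_def by auto
  show ?thesis unfolding det_exec_def
    by (intro exI[of _ "1 + cost s e + t"])
      (use exec.CondFalse[OF assms(1) t(2), of c] t(1) in \<open>auto simp: tick_def\<close>)
qed

text \<open>One polynomial bounds both the time and the size of the output. The claim covers all
  values, so that composition carries no side conditions; in return every function has to stay
  polynomial on values that encode nothing.\<close>

definition computes :: "com \<Rightarrow> (val \<Rightarrow> val) \<Rightarrow> nat poly \<Rightarrow> bool" where
  "computes c f p \<longleftrightarrow> flip_free c \<and> (\<forall>x. vsize (f x) \<le> poly p (vsize x) \<and>
     (\<exists>s. det_exec c (init x) s (poly p (vsize x)) \<and> s 0 = f x))"

definition ptime :: "(val \<Rightarrow> val) \<Rightarrow> bool" where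
  "ptime f \<longleftrightarrow> (\<exists>c p. computes c f p)"

text \<open>The size of the output follows from the time: by \<open>exec_vsize\<close> it is at most
  \<open>n + 2 * T n\<close>, which serves as the common bound.\<close>

lemma ptimeI:
  assumes "flip_free c" "poly_bounded T"
    "\<And>x. \<exists>s. det_exec c (init x) s (T (vsize x)) \<and> s 0 = f x"
  shows "ptime f"
proof -
  have "poly_bounded (\<lambda>n. n + 2 * T n)" by (intro poly_bounded_intros assms)
  then obtain p where p: "n + 2 * T n \<le> poly p n" for n unfolding poly_bounded_def by auto
  have "computes c f p" unfolding computes_def
  proof (intro conjI allI assms(1))
    fix x
    from assms(3) obtain s where s: "det_exec c (init x) s (T (vsize x))" "s 0 = f x" by blast
    then obtain t where t: "t \<le> T (vsize x)" "exec c (init x) (return_pmf (s, t))"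
      unfolding det_exec_def by auto
    show "vsize (f x) \<le> poly p (vsize x)"
      using exec_vsize[OF t(2), of s t 0] t(1) s(2) p[of "vsize x"] by (simp add: init_def)
    have "T (vsize x) \<le> poly p (vsize x)" using p[of "vsize x"] by simp
    then show "\<exists>s. det_exec c (init x) s (poly p (vsize x)) \<and> s 0 = f x"
      using det_exec_mono s by blast
  qed
  then show ?thesis unfolding ptime_def by blast
qed

text \<open>\<open>Call\<close> charges the time of the callee and, once more, the size of its
  output; \<open>p\<close> bounds both, hence the factor 2.\<close>

lemma det_exec_Call:
  assumes "computes c f p"
  shows "det_exec (Call y c e) s (s(y := f (eval s e)))
    (1 + cost s e + 2 * poly p (vsize (eval s e)))"
proof -
  from assms obtain s' t where *: "vsize (f (eval s e)) \<le> poly p (vsize (eval s e))"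
    "exec c (init (eval s e)) (return_pmf (s', t))" "t \<le> poly p (vsize (eval s e))"
    "s' 0 = f (eval s e)"
    unfolding computes_def det_exec_def by blast
  show ?thesis unfolding det_exec_def
    by (intro exI[of _ "1 + cost s e + t + vsize (f (eval s e))"] conjI)
      (use * exec.Call[OF *(2)] in simp_all)
qed

lemma ptime_id: "ptime (\<lambda>x. x)"
proof (rule ptimeI)
  show "\<exists>s. det_exec (Assign 0 (Var 0)) (init x) s (2 + vsize x) \<and> s 0 = x" for x
    using det_exec_Assign[of 0 "Var 0" "init x"] by (intro exI) (auto simp: init_def)
qed (simp, intro poly_bounded_intros)

lemma ptime_compose:
  assumes "ptime f" "ptime g"
  shows "ptime (\<lambda>x. g (f x))"
proof -
  from assms obtain c p d q where c: "computes c f p" and d: "computes d g q"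
    unfolding ptime_def by auto
  define T where "T n = (2 + n + 2 * poly p n) + (2 + poly p n + 2 * poly q (poly p n))" for n
  show ?thesis
  proof (rule ptimeI)
    show "flip_free (Seq (Call 1 c (Var 0)) (Call 0 d (Var 1)))"
      using c d by (simp add: computes_def)
    show "poly_bounded T" unfolding T_def by (intro poly_bounded_intros)
    fix x
    have "vsize (f x) \<le> poly p (vsize x)" using c by (simp add: computes_def)
    then have "poly q (vsize (f x)) \<le> poly q (poly p (vsize x))"
      by (rule poly_nat_mono)
    with \<open>vsize (f x) \<le> poly p (vsize x)\<close>
    show "\<exists>s. det_exec (Seq (Call 1 c (Var 0)) (Call 0 d (Var 1))) (init x) s (T (vsize x)) \<and> s 0 = g (f x)"
      by - (intro exI conjI, rule det_exec_mono, rule det_exec_Seq, rule det_exec_Call[OF c],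
          rule det_exec_Call[OF d], auto simp: T_def init_def)
  qed
qed

text \<open>One scheme for all primitive operations: the arguments are computed into variables 1 and
  2 and combined by \<open>e\<close> at a cost linear in their sizes. For unary operations and
  constants \<open>F\<close> is constant in what \<open>e\<close> does not read.\<close>

lemma ptime_op:
  assumes "\<And>s. eval s e = F (s 1) (s 2)"
    and "\<And>s. cost s e \<le> k * (vsize (s 1) + vsize (s 2)) + k"
    and f: "ptime f" and g: "ptime g"
  shows "ptime (\<lambda>x. F (f x) (g x))"
proof -
  from f g obtain c p d q where c: "computes c f p" and d: "computes d g q"
    unfolding ptime_def by auto
  define T where "T n = (2 + n + 2 * poly p n) + ((2 + n + 2 * poly q n) +
    (1 + (k * (poly p n + poly q n) + k)))" for n
  let ?C = "Seq (Call 1 c (Var 0)) (Seq (Call 2 d (Var 0)) (Assign 0 e))"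
  show ?thesis
  proof (rule ptimeI)
    show "flip_free ?C"
      using c d by (simp add: computes_def)
    show "poly_bounded T" unfolding T_def by (intro poly_bounded_intros)
    fix x
    let ?s = "(init x)(1 := f x, 2 := g x)"
    have "vsize (f x) + vsize (g x) \<le> poly p (vsize x) + poly q (vsize x)"
      using c d by (simp add: computes_def add_mono)
    then have "k * (vsize (f x) + vsize (g x)) \<le> k * (poly p (vsize x) + poly q (vsize x))"
      by (rule mult_le_mono2)
    moreover have "cost ?s e \<le> k * (vsize (f x) + vsize (g x)) + k"
      using assms(2)[of ?s] by simp
    ultimately have *: "cost ?s e \<le> k * (poly p (vsize x) + poly q (vsize x)) + k"
      by linarith
    show "\<exists>s. det_exec ?C (init x) s (T (vsize x)) \<and> s 0 = F (f x) (g x)"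
      by (intro exI conjI, rule det_exec_mono, rule det_exec_Seq, rule det_exec_Call[OF c],
          rule det_exec_Seq, rule det_exec_Call[OF d], rule det_exec_Assign)
        (use * in \<open>auto simp: T_def init_def assms(1) fun_upd_def\<close>)
  qed
qed

lemma ptime_Num_const: "ptime (\<lambda>x. Num n)"
  by (rule ptime_op[OF _ _ ptime_id ptime_id, of "Const n" "\<lambda>u v. Num n" "3 + nat (bitlen (int n))"]) auto

lemma ptime_Node: "ptime f \<Longrightarrow> ptime g \<Longrightarrow> ptime (\<lambda>x. Node (f x) (g x))"
  by (rule ptime_op[of "MkNode (Var 1) (Var 2)" Node 4]) auto

lemma ptime_left: "ptime f \<Longrightarrow> ptime (\<lambda>x. left (f x))"
  by (rule ptime_op[of "Left (Var 1)" "\<lambda>u v. left u" 3])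
    (auto intro: le_trans[OF vsize_left] simp: add_mono)

lemma ptime_right: "ptime f \<Longrightarrow> ptime (\<lambda>x. right (f x))"
  by (rule ptime_op[of "Right (Var 1)" "\<lambda>u v. right u" 3])
    (auto intro: le_trans[OF vsize_right] simp: add_mono)

lemma ptime_op2:
  assumes op: "\<And>s a b. eval s (E a b) = F (eval s a) (eval s b)"
    "\<And>s a b. cost s (E a b) = 1 + vsize (eval s (E a b)) + cost s a + cost s b"
    and F: "\<And>u v. vsize (F u v) \<le> vsize u + vsize v + 2"
    and "ptime f" "ptime g"
  shows "ptime (\<lambda>x. F (f x) (g x))"
proof (rule ptime_op[of "E (Var 1) (Var 2)" F 5, OF _ _ assms(4,5)])
  fix s :: state
  show "cost s (E (Var 1) (Var 2)) \<le> 5 * (vsize (s 1) + vsize (s 2)) + 5"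
    using F[of "s 1" "s 2"] by (simp add: op)
qed (simp add: op)

lemma vsize_op_num:
  "vsize (Num (num_of u + num_of v)) \<le> vsize u + vsize v + 2"
  "vsize (Num (num_of u * num_of v)) \<le> vsize u + vsize v + 2"
  using vsize_add[of "num_of u" "num_of v"] vsize_mult[of "num_of u" "num_of v"]
    vsize_Num_num_of[of u] vsize_Num_num_of[of v]
  by (simp_all del: vsize.simps)

lemma vsize_op_truth: "vsize (of_truth b) \<le> vsize u + vsize v + 2"
  by simp

lemma ptime_num_of: "ptime f \<Longrightarrow> ptime (\<lambda>x. Num (num_of (f x)))"
  using ptime_op2[of Add "\<lambda>u v. Num (num_of u + num_of v)" f "\<lambda>x. Num 0",
      OF _ _ vsize_op_num(1) _ ptime_Num_const] by simp

lemma ptime_add: "ptime (\<lambda>x. Num (f x)) \<Longrightarrow> ptime (\<lambda>x. Num (g x)) \<Longrightarrow> ptime (\<lambda>x. Num (f x + g x))"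
  using ptime_op2[of Add "\<lambda>u v. Num (num_of u + num_of v)" "\<lambda>x. Num (f x)" "\<lambda>x. Num (g x)",
      OF _ _ vsize_op_num(1)] by simp

lemma ptime_mult: "ptime (\<lambda>x. Num (f x)) \<Longrightarrow> ptime (\<lambda>x. Num (g x)) \<Longrightarrow> ptime (\<lambda>x. Num (f x * g x))"
  using ptime_op2[of Mul "\<lambda>u v. Num (num_of u * num_of v)" "\<lambda>x. Num (f x)" "\<lambda>x. Num (g x)",
      OF _ _ vsize_op_num(2)] by simp

lemma ptime_less: "ptime (\<lambda>x. Num (f x)) \<Longrightarrow> ptime (\<lambda>x. Num (g x)) \<Longrightarrow> ptime (\<lambda>x. of_truth (f x < g x))"
  using ptime_op2[of Less "\<lambda>u v. of_truth (num_of u < num_of v)" "\<lambda>x. Num (f x)" "\<lambda>x. Num (g x)",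
      OF _ _ vsize_op_truth] by simp

lemma ptime_eq: "ptime f \<Longrightarrow> ptime g \<Longrightarrow> ptime (\<lambda>x. of_truth (f x = g x))"
  by (rule ptime_op2[of Equal "\<lambda>u v. of_truth (u = v)"]) simp_all

lemma ptime_eq_nat:
  "ptime (\<lambda>x. Num (f x)) \<Longrightarrow> ptime (\<lambda>x. Num (g x)) \<Longrightarrow> ptime (\<lambda>x. of_truth (f x = g x))"
  using ptime_eq[of "\<lambda>x. Num (f x)" "\<lambda>x. Num (g x)"] by simp

lemma ptime_is_node: "ptime f \<Longrightarrow> ptime (\<lambda>x. of_truth (is_node (f x)))"
  by (rule ptime_op[of "IsNode (Var 1)" "\<lambda>u v. of_truth (is_node u)" 4]) simp_all

lemma ptime_if:
  assumes "ptime (\<lambda>x. of_truth (P x))" "ptime f" "ptime g"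
  shows "ptime (\<lambda>x. if P x then f x else g x)"
proof -
  from assms obtain b r c p d q where b: "computes b (\<lambda>x. of_truth (P x)) r"
    and c: "computes c f p" and d: "computes d g q"
    unfolding ptime_def by auto
  define T where "T n = (2 + n + 2 * poly r n) + (4 + (2 + n + 2 * poly p n + 2 * poly q n))" for n
  let ?C = "Seq (Call 1 b (Var 0)) (Cond (Var 1) (Call 0 c (Var 0)) (Call 0 d (Var 0)))"
  show ?thesis
  proof (rule ptimeI)
    show "flip_free ?C"
      using b c d by (simp add: computes_def)
    show "poly_bounded T" unfolding T_def by (intro poly_bounded_intros)
    fix x
    let ?s = "(init x)(1 := of_truth (P x))"
    have 1: "det_exec (Call 1 b (Var 0)) (init x) ?s (2 + vsize x + 2 * poly r (vsize x))"
      using det_exec_Call[OF b, of 1 "Var 0" "init x"] by (simp add: init_def)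
    have v: "vsize (of_truth (P x)) \<le> 2" by (rule vsize_of_truth)
    have 2: "det_exec (Cond (Var 1) (Call 0 c (Var 0)) (Call 0 d (Var 0))) ?s
       (?s(0 := if P x then f x else g x)) (4 + (2 + vsize x + 2 * poly p (vsize x) +
           2 * poly q (vsize x)))"
    proof (cases "P x")
      case True
      then have "truth (eval ?s (Var 1))" by simp
      from det_exec_CondTrue[OF this det_exec_Call[OF c, of 0 "Var 0" ?s], of "Call 0 d (Var 0)"] v True
          show ?thesis
        by (auto simp: init_def elim!: det_exec_mono)
    next
      case False
      then have "\<not> truth (eval ?s (Var 1))" by simp
      from det_exec_CondFalse[OF this det_exec_Call[OF d, of 0 "Var 0" ?s], of "Call 0 c (Var 0)"] v
          False show ?thesis
        by (auto simp: init_def elim!: det_exec_mono)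
    qed
    show "\<exists>s. det_exec ?C (init x) s (T (vsize x)) \<and> s 0 = (if P x then f x else g x)"
      using det_exec_Seq[OF 1 2] unfolding T_def
      by (intro exI[of _ "?s(0 := if P x then f x else g x)"]) simp
  qed
qed

section \<open>Folding over list values\<close>

primrec vlist :: "val \<Rightarrow> val list" where
  "vlist (Num n) = []"
| "vlist (Node a b) = a # vlist b"

lemma vlist_enc_list [simp]: "vlist (enc_list f xs) = map f xs"
  by (induction xs) auto

lemma enc_list_map: "enc_list f (map g xs) = enc_list (\<lambda>x. f (g x)) xs"
  by (induction xs) auto

text \<open>The growth has to be additive: each element adds at most \<open>k\<close>, and there are
  fewer elements than \<open>vsize l\<close>. A step that could double the accumulator would allow
  exponential size.\<close>

lemma vsize_fold_le:
  assumes "\<And>e a. e \<in> set (vlist l) \<Longrightarrow> vsize (g e a) \<le> vsize a + k"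
  shows "vsize (fold g (vlist l) a) \<le> vsize a + vsize l * k"
  using assms
proof (induction l arbitrary: a)
  case (Node e l)
  have "vsize (fold g (vlist (Node e l)) a) \<le> vsize (g e a) + vsize l * k"
    using Node.IH(2)[of "g e a"] Node.prems by simp
  then show ?case using Node.prems[of e a] by (simp add: algebra_simps)
qed simp

lemma vsize_vlist: "e \<in> set (vlist l) \<Longrightarrow> vsize e < vsize l"
  by (induction l) auto

text \<open>Variable 1 holds the parameter, 2 the rest of the list, 3 the accumulator.\<close>

definition fold_body :: "com \<Rightarrow> com" where
  "fold_body c =
    Seq (Call 3 c (MkNode (MkNode (Var 1) (Left (Var 2))) (Var 3))) (Assign 2 (Right (Var 2)))"

text \<open>The invariant is \<open>vsize a + vsize l * k \<le> S\<close>: a round adds at most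
  \<open>k\<close> to the accumulator and takes at least one from \<open>vsize l\<close>. Hence
  \<open>S\<close> bounds every accumulator, all rounds share one cost bound, and there are fewer
  than \<open>vsize l\<close> of them.\<close>

lemma det_exec_fold_loop:
  assumes c: "computes c (\<lambda>z. g (left (left z)) (right (left z)) (right z)) p"
    and g: "\<And>e a. vsize e \<le> L \<Longrightarrow> vsize (g x e a) \<le> vsize a + k"
  shows "s 1 = x \<Longrightarrow> s 2 = l \<Longrightarrow> s 3 = a \<Longrightarrow> vsize l \<le> L \<Longrightarrow> vsize a + vsize l * k \<le> S \<Longrightarrow>
    \<exists>s'. det_exec (While (IsNode (Var 2)) (fold_body c)) s s'
      (vsize l * (2 * poly p (2 + vsize x + L + S) + 3 * vsize x + 8 * L + 2 * S + 30)) \<and>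
      s' 3 = fold (g x) (vlist l) a"
proof (induction l arbitrary: s a)
  case (Num n)
  have "\<not> truth (eval s (IsNode (Var 2)))" using Num by (simp add: truth_def of_truth_def)
  from det_exec_WhileFalse[OF this, of "fold_body c"]
  have "det_exec (While (IsNode (Var 2)) (fold_body c)) s s (1 + cost s (IsNode (Var 2)))" .
  moreover have "1 + cost s (IsNode (Var 2)) \<le> vsize (Num n) * (8 * L + 30)"
    using Num.prems(2,4) vsize_of_truth[of False]
    by (simp add: add_increasing)
  ultimately show ?case using Num.prems
    by (intro exI[of _ s]) (auto elim!: det_exec_mono intro: le_trans simp: add_mult_distrib2)
next
  case (Node e l)
  let ?K = "2 * poly p (2 + vsize x + L + S) + 3 * vsize x + 8 * L + 2 * S + 30"
  let ?a = "g x e a"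
  let ?s = "s(3 := ?a, 2 := l)"
  have t: "truth (eval s (IsNode (Var 2)))" using Node by simp
  have vs: "vsize (g x e a) \<le> vsize a + k" using g[of e a] Node.prems by simp
  have *: "det_exec (fold_body c) s ?s
    (1 + cost s (MkNode (MkNode (Var 1) (Left (Var 2))) (Var 3)) +
       2 * poly p (vsize (Node (Node x e) a)) + (4 + vsize l + vsize (Node e l)))"
    unfolding fold_body_def
    by (rule det_exec_mono, rule det_exec_Seq, rule det_exec_Call[OF c], rule det_exec_Assign[THEN
        subst[of _ _ "\<lambda>s'. det_exec _ _ s' _", rotated]])
      (use Node.prems in auto)
  have "vsize a \<le> S" using Node.prems by simp
  then have "poly p (vsize (Node (Node x e) a)) \<le> poly p (2 + vsize x + L + S)"
    using Node.prems by (intro poly_nat_mono) simp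
  then have b: "1 + cost s (IsNode (Var 2)) + (1 + cost s (MkNode (MkNode (Var 1) (Left (Var 2))) (Var 3)) +
       2 * poly p (vsize (Node (Node x e) a)) + (4 + vsize l + vsize (Node e l))) \<le> ?K"
    using Node.prems \<open>vsize a \<le> S\<close> vsize_of_truth[of True] by simp
  obtain s' where s': "det_exec (While (IsNode (Var 2)) (fold_body c)) ?s s' (vsize l * ?K)"
      "s' 3 = fold (g x) (vlist l) ?a"
  proof -
    have "?s 1 = x" "?s 2 = l" "?s 3 = ?a" "vsize l \<le> L" "vsize ?a + vsize l * k \<le> S"
      using Node.prems vs by (simp_all add: algebra_simps)
    from Node.IH(2)[OF this] show thesis using that by blast
  qed
  show ?case
  proof (intro exI conjI)
    show "det_exec (While (IsNode (Var 2)) (fold_body c)) s s' (vsize (Node e l) * ?K)"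
      by (rule det_exec_mono[OF det_exec_WhileTrue[OF t * s'(1)]])
        (rule le_trans[OF add_right_mono[OF b]], simp)
  qed (use s' in simp)
qed

text \<open>The one loop from which all list functions are derived. Parameter, list and accumulator
  arrive packed in the single input \<open>z\<close>.\<close>

lemma ptime_fold_triple:
  assumes c: "ptime (\<lambda>z. g (left (left z)) (right (left z)) (right z))"
    and g: "\<And>x e a. vsize (g x e a) \<le> vsize a + poly q (vsize x + vsize e)"
  shows "ptime (\<lambda>z. fold (g (left z)) (vlist (left (right z))) (right (right z)))"
proof -
  from c obtain c p where c: "computes c (\<lambda>z. g (left (left z)) (right (left z)) (right z)) p"
    unfolding ptime_def by blast
  define S where "S n = n + n * poly q (n + n)" for n
  define K where "K n = 2 * poly p (2 + n + n + S n) + 3 * n + 8 * n + 2 * S n + 30" for n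
  define T where "T n = (100 + 20 * n) + n * K n" for n
  let ?init = "Seq (Assign 1 (Left (Var 0))) (Seq (Assign 2 (Left (Right (Var 0)))) (Assign 3 (Right
      (Right (Var 0)))))"
  let ?C = "Seq ?init (Seq (While (IsNode (Var 2)) (fold_body c)) (Assign 0 (Var 3)))"
  show ?thesis
  proof (rule ptimeI)
    show "flip_free ?C" using c by (simp add: computes_def fold_body_def)
    \<comment> \<open>The extra \<open>S n\<close> pays for copying the result into variable
      0.\<close>
    show "poly_bounded (\<lambda>n. T n + S n)" unfolding T_def K_def S_def by (intro poly_bounded_intros)
    fix z
    define x l a where "x = left z" "l = left (right z)" "a = right (right z)"
    let ?n = "vsize z"
    have sz: "vsize x \<le> ?n" "vsize l \<le> ?n" "vsize a \<le> ?n" "vsize a + vsize l \<le> Suc ?n"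
        "vsize (right z) \<le> ?n"
      unfolding x_l_a_def by (cases z; cases "right z"; auto)+
    let ?s = "(init z)(1 := x, 2 := l, 3 := a)"
    have 1: "det_exec ?init (init z) ?s (90 + 20 * ?n)"
      by (rule det_exec_mono, rule det_exec_Seq, rule det_exec_Assign, rule det_exec_Seq,
          rule det_exec_Assign,
        rule det_exec_Assign[THEN subst[of _ _ "\<lambda>s'. det_exec _ _ s' _", rotated]])
       (use sz in \<open>auto simp: init_def x_l_a_def\<close>)
    have "vsize (g x e a) \<le> vsize a + poly q (?n + ?n)" if "vsize e \<le> ?n" for e a
      using g[of x e a] poly_nat_mono[of "vsize x + vsize e" "?n + ?n" q] sz that by linarith
    moreover have "vsize a + vsize l * poly q (?n + ?n) \<le> S ?n"
      unfolding S_def using sz by (intro add_mono mult_le_mono1)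
    ultimately obtain s' where s': "det_exec (While (IsNode (Var 2)) (fold_body c)) ?s s'
        (vsize l * (2 * poly p (2 + vsize x + ?n + S ?n) + 3 * vsize x + 8 * ?n + 2 * S ?n + 30))"
      "s' 3 = fold (g x) (vlist l) a"
      using det_exec_fold_loop[OF c, of ?n x "poly q (?n + ?n)" ?s l a "S ?n"] sz by auto
    have "vsize l * (2 * poly p (2 + vsize x + ?n + S ?n) + 3 * vsize x + 8 * ?n + 2 * S ?n + 30) \<le>
        ?n * K ?n"
      unfolding K_def using sz by (intro mult_le_mono add_mono poly_nat_mono) simp_all
    moreover have "vsize (s' 3) \<le> S ?n"
    proof -
      have "vsize (fold (g x) (vlist l) a) \<le> vsize a + vsize l * poly q (?n + ?n)"
        using \<open>\<And>e a. vsize e \<le> ?n \<Longrightarrow> vsize (g x e a) \<le> vsize a + poly q (?n + ?n)\<close> sz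
        by (intro vsize_fold_le) (use vsize_vlist le_trans less_imp_le in meson)
      then show ?thesis using \<open>vsize a + vsize l * poly q (?n + ?n) \<le> S ?n\<close> s' by simp
    qed
    ultimately show "\<exists>s. det_exec ?C (init z) s (T ?n + S ?n) \<and>
        s 0 = fold (g (left z)) (vlist (left (right z))) (right (right z))"
      using s'(2)
      by - (intro exI conjI, rule det_exec_mono, rule det_exec_Seq, rule 1, rule det_exec_Seq, rule s'(1),
          rule det_exec_Assign, auto simp: T_def x_l_a_def)
  qed
qed

lemma ptime_fold:
  assumes "ptime l" "ptime a" "ptime (\<lambda>z. g (left (left z)) (right (left z)) (right z))"
    and "\<And>x e a. vsize (g x e a) \<le> vsize a + poly q (vsize x + vsize e)"
  shows "ptime (\<lambda>x. fold (g x) (vlist (l x)) (a x))"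
  using ptime_compose[OF _ ptime_fold_triple[of g q, OF assms(3,4)], of "\<lambda>x. Node x (Node (l x) (a x))"]
  by (simp add: ptime_Node ptime_id assms)

section \<open>Polynomial time list functions\<close>

text \<open>Supplies the growth condition of \<open>ptime_fold\<close> when a step function is built
  from a polynomial time one. The shift \<open>[:1, 1:]\<close> accounts for the node that pairs the
  two arguments.\<close>

lemma ptime_size:
  assumes "ptime (\<lambda>z. f (left z) (right z))"
  shows "\<exists>q. \<forall>x e. vsize (f x e) \<le> poly q (vsize x + vsize e)"
proof -
  from assms obtain c p where c: "computes c (\<lambda>z. f (left z) (right z)) p"
    unfolding ptime_def by blast
  have "vsize (f x e) \<le> poly (p \<circ>\<^sub>p [:1, 1:]) (vsize x + vsize e)" for x e
    using c[unfolded computes_def, THEN conjunct2, THEN spec, of "Node x e"]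
    by (simp add: poly_pcompose)
  then show ?thesis by blast
qed

lemma fold_Node: "fold Node xs (enc_list id ys) = enc_list id (rev xs @ ys)"
proof (induction xs arbitrary: ys)
  case (Cons x xs)
  show ?case using Cons[of "x # ys"] by simp
qed simp

lemma vsize_fold_Node: "vsize (fold Node (vlist l) a) \<le> vsize a + vsize l"
proof (induction l arbitrary: a)
  case (Node e l)
  show ?case using Node.IH(2)[of "Node e a"] by simp
qed simp

text \<open>Two reversals copy a list value and normalise it: \<open>vlist\<close> accepts any final
  leaf, whereas \<open>enc_list\<close> always ends in \<open>Num 0\<close>.\<close>

lemma ptime_vlist:
  assumes "ptime l"
  shows "ptime (\<lambda>x. enc_list id (vlist (l x)))"
    and ptime_rev_vlist: "ptime (\<lambda>x. enc_list id (rev (vlist (l x))))"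
proof -
  have *: "ptime (\<lambda>x. enc_list id (rev (vlist (l x))))" if "ptime l" for l
  proof -
    have "ptime (\<lambda>x. fold (\<lambda>e a. Node e a) (vlist (l x)) (Num 0))"
      by (rule ptime_fold[where g = "\<lambda>x e a. Node e a" and q = "[:1, 1:]"])
        (auto intro!: ptime_Node ptime_right ptime_left ptime_id ptime_Num_const that)
    then show ?thesis using fold_Node[of _ "[]"] by simp
  qed
  from *[OF assms] show "ptime (\<lambda>x. enc_list id (rev (vlist (l x))))" .
  from *[OF this] show "ptime (\<lambda>x. enc_list id (vlist (l x)))" by simp
qed

lemma ptime_rev: "ptime (\<lambda>x. enc_list id (L x)) \<Longrightarrow> ptime (\<lambda>x. enc_list id (rev (L x)))"
  using ptime_rev_vlist[of "\<lambda>x. enc_list id (L x)"] by simp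

lemma ptime_fold_Node:
  assumes "ptime l" "ptime a"
  shows "ptime (\<lambda>x. fold Node (vlist (l x)) (a x))"
  by (rule ptime_fold[where g = "\<lambda>x e a. Node e a" and q = "[:1, 1:]"])
    (auto intro!: ptime_Node ptime_right ptime_left ptime_id assms)

lemma ptime_Nil: "ptime (\<lambda>x. enc_list id [])"
  by (simp add: ptime_Num_const)

lemma ptime_Cons:
  "ptime f \<Longrightarrow> ptime (\<lambda>x. enc_list id (L x)) \<Longrightarrow> ptime (\<lambda>x. enc_list id (f x # L x))"
  by (simp add: ptime_Node)

lemma ptime_append:
  assumes "ptime (\<lambda>x. enc_list id (K x))" "ptime (\<lambda>x. enc_list id (L x))"
  shows "ptime (\<lambda>x. enc_list id (K x @ L x))"
  using ptime_fold_Node[OF ptime_rev[OF assms(1)] assms(2)] by (simp add: fold_Node)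

lemma fold_append_rev: "fold (\<lambda>e a. F e @ a) (rev xs) ys = concat (map F xs) @ ys"
  by (induction xs arbitrary: ys) auto

text \<open>The source of \<open>map\<close> and \<open>filter\<close>. Folding with
  \<open>Node\<close> reverses, so both the list and each piece are reversed beforehand. The size of
  a piece does not depend on the accumulator, which makes the growth additive.\<close>

lemma ptime_concat_map:
  assumes L: "ptime (\<lambda>x. enc_list id (L x))"
    and F: "ptime (\<lambda>z. enc_list id (F (left z) (right z)))"
  shows "ptime (\<lambda>x. enc_list id (concat (map (F x) (L x))))"
proof -
  define g where "g x e a = fold Node (rev (F x e)) a" for x e a
  have rF: "ptime (\<lambda>z. enc_list id (rev (F (left z) (right z))))"
    by (rule ptime_rev[OF F])
  have *: "ptime (\<lambda>z. g (left (left z)) (right (left z)) (right z))"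
    using ptime_fold_Node[OF ptime_compose[OF ptime_left[OF ptime_id] rF] ptime_right[OF ptime_id]]
    by (simp add: g_def)
  obtain q where q: "vsize (enc_list id (rev (F x e))) \<le> poly q (vsize x + vsize e)" for x e
    using ptime_size[of "\<lambda>x e. enc_list id (rev (F x e))"] rF by auto
  have "vsize (g x e a) \<le> vsize a + poly q (vsize x + vsize e)" for x e a
    using vsize_fold_Node[of "enc_list id (rev (F x e))" a] q[of x e] by (simp add: g_def)
  from ptime_fold[OF ptime_rev[OF L] ptime_Num_const * this, of 0]
  have "ptime (\<lambda>x. fold (g x) (rev (L x)) (Num 0))" by simp
  moreover have "fold (g x) xs (enc_list id ys) = enc_list id (fold (\<lambda>e a. F x e @ a) xs ys)" for x xs ys
    by (induction xs arbitrary: ys) (auto simp: g_def fold_Node)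
  from this[of _ _ "[]"] have "fold (g x) (rev (L x)) (Num 0) = enc_list id (concat (map (F x) (L x)))"
      for x
    by (simp add: fold_append_rev)
  ultimately show ?thesis by simp
qed

lemma ptime_if_list:
  assumes "ptime (\<lambda>x. of_truth (P x))" "ptime (\<lambda>x. enc_list id (K x))" "ptime (\<lambda>x. enc_list id (L x))"
  shows "ptime (\<lambda>x. enc_list id (if P x then K x else L x))"
  using ptime_if[OF assms] by (simp add: if_distrib)

lemma ptime_if_nat:
  assumes "ptime (\<lambda>x. of_truth (P x))" "ptime (\<lambda>x. Num (m x))" "ptime (\<lambda>x. Num (n x))"
  shows "ptime (\<lambda>x. Num (if P x then m x else n x))"
  using ptime_if[OF assms] by (simp add: if_distrib)

lemma ptime_map:
  assumes "ptime (\<lambda>x. enc_list id (L x))" "ptime (\<lambda>z. F (left z) (right z))"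
  shows "ptime (\<lambda>x. enc_list id (map (F x) (L x)))"
proof -
  have "ptime (\<lambda>x. enc_list id (concat (map (\<lambda>e. [F x e]) (L x))))"
    by (intro ptime_concat_map ptime_Cons ptime_Nil assms)
  then show ?thesis by (simp add: concat_map_singleton)
qed

lemma ptime_filter:
  assumes "ptime (\<lambda>x. enc_list id (L x))" "ptime (\<lambda>z. of_truth (P (left z) (right z)))"
  shows "ptime (\<lambda>x. enc_list id (filter (P x) (L x)))"
proof -
  have "ptime (\<lambda>x. enc_list id (concat (map (\<lambda>e. if P x e then [e] else []) (L x))))"
    by (intro ptime_concat_map ptime_if_list ptime_Cons ptime_Nil ptime_right ptime_id assms)
  moreover have "concat (map (\<lambda>e. if P x e then [e] else []) xs) = filter (P x) xs" for x xs
    by (induction xs) auto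
  ultimately show ?thesis by simp
qed

lemma ptime_sum_list:
  assumes L: "ptime (\<lambda>x. enc_list id (L x))" and F: "ptime (\<lambda>z. Num (F (left z) (right z)))"
  shows "ptime (\<lambda>x. Num (sum_list (map (F x) (L x))))"
proof -
  obtain q where q: "vsize (Num (F x e)) \<le> poly q (vsize x + vsize e)" for x e
    using ptime_size[of "\<lambda>x e. Num (F x e)"] F by auto
  define g where "g x e a = Num (num_of a + F x e)" for x e a
  have *: "ptime (\<lambda>z. g (left (left z)) (right (left z)) (right z))"
    unfolding g_def
    by (intro ptime_add ptime_num_of ptime_right ptime_id ptime_compose[OF ptime_left[OF ptime_id] F])
  have "vsize (g x e a) \<le> vsize a + poly q (vsize x + vsize e)" for x e a
    unfolding g_def using vsize_add[of "num_of a" "F x e"] vsize_Num_num_of[of a] q[of x e] by linarith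
  from ptime_fold[OF L ptime_Num_const * this, of 0]
  have "ptime (\<lambda>x. fold (g x) (L x) (Num 0))" by simp
  moreover have "fold (g x) xs (Num n) = Num (n + sum_list (map (F x) xs))" for x xs n
    by (induction xs arbitrary: n) (auto simp: g_def)
  ultimately show ?thesis by simp
qed

lemma ptime_length:
  assumes "ptime (\<lambda>x. enc_list id (L x))"
  shows "ptime (\<lambda>x. Num (length (L x)))"
  using ptime_sum_list[OF assms ptime_Num_const, of 1] by (simp add: sum_list_triv)

lemma ptime_not:
  assumes "ptime (\<lambda>x. of_truth (P x))"
  shows "ptime (\<lambda>x. of_truth (\<not> P x))"
proof -
  have "of_truth (\<not> P x) = (if P x then Num 0 else Num 1)" for x
    by (simp add: of_truth_def)
  then show ?thesis using ptime_if[OF assms ptime_Num_const ptime_Num_const] by simp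
qed

lemma ptime_conj:
  assumes "ptime (\<lambda>x. of_truth (P x))" "ptime (\<lambda>x. of_truth (Q x))"
  shows "ptime (\<lambda>x. of_truth (P x \<and> Q x))"
proof -
  have "ptime (\<lambda>x. if P x then of_truth (Q x) else Num 0)"
    by (intro ptime_if assms ptime_Num_const)
  moreover have "of_truth (P x \<and> Q x) = (if P x then of_truth (Q x) else Num 0)" for x
    by (simp add: of_truth_def)
  ultimately show ?thesis by simp
qed

lemma ptime_disj:
  assumes "ptime (\<lambda>x. of_truth (P x))" "ptime (\<lambda>x. of_truth (Q x))"
  shows "ptime (\<lambda>x. of_truth (P x \<or> Q x))"
  using ptime_not[OF ptime_conj[OF assms[THEN ptime_not]]] by simp

lemma ptime_Ball:
  assumes "ptime (\<lambda>x. enc_list id (L x))" "ptime (\<lambda>z. of_truth (P (left z) (right z)))"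
  shows "ptime (\<lambda>x. of_truth (\<forall>e\<in>set (L x). P x e))"
proof -
  have "ptime (\<lambda>x. of_truth (length (filter (\<lambda>e. \<not> P x e) (L x)) = 0))"
    by (intro ptime_eq_nat ptime_length ptime_filter ptime_not ptime_Num_const assms)
  then show ?thesis by (simp add: filter_empty_conv)
qed

lemma ptime_mem:
  assumes "ptime f" "ptime (\<lambda>x. enc_list id (L x))"
  shows "ptime (\<lambda>x. of_truth (f x \<in> set (L x)))"
proof -
  have "ptime (\<lambda>x. of_truth (\<not> (\<forall>e\<in>set (L x). e \<noteq> f x)))"
    by (intro ptime_not ptime_Ball ptime_eq ptime_compose[OF ptime_left[OF ptime_id] assms(1)]
        ptime_right ptime_id assms(2))
  then show ?thesis by simp
qed

text \<open>A fold over the first list whose accumulator is a pair: the rest of the second list, and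
  the pairs found so far in reverse order. Once the second list is exhausted the accumulator stays
  fixed, which is the truncation done by \<open>zip\<close>.\<close>

lemma ptime_zip:
  assumes K: "ptime (\<lambda>x. enc_list id (K x))" and L: "ptime (\<lambda>x. enc_list id (L x))"
  shows "ptime (\<lambda>x. enc_list id (map2 Node (K x) (L x)))"
proof -
  define g where "g e a = (if is_node (left a)
     then Node (right (left a)) (Node (Node e (left (left a))) (right a)) else a)" for e a
  have "vsize (g e a) \<le> vsize a + poly [:2, 1:] (vsize x + vsize e)" for x e a :: val
    by (cases a; cases "left a") (auto simp: g_def)
  note * = ptime_fold[OF K ptime_Node[OF L ptime_Num_const[of 0]] _ this]
  have "ptime (\<lambda>x. right (fold g (vlist (enc_list id (K x))) (Node (enc_list id (L x)) (Num 0))))"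
    unfolding g_def
    by (rule ptime_right, rule *[unfolded g_def])
      (intro ptime_if ptime_is_node ptime_Node ptime_right ptime_left ptime_id)
  moreover have "right (fold g xs (Node (enc_list id ys) (enc_list id zs)))
      = enc_list id (rev (map2 Node xs ys) @ zs)" for xs ys zs
  proof (induction xs arbitrary: ys zs)
    case (Cons a xs)
    note IH = Cons.IH
    have [simp]: "fold g xs (Node (Num 0) v) = Node (Num 0) v" for xs v
      by (induction xs) (auto simp: g_def)
    show ?case
    proof (cases ys)
      case (Cons b ys')
      have "g a (Node (enc_list id ys) (enc_list id zs))
          = Node (enc_list id ys') (enc_list id (Node a b # zs))"
        by (simp add: g_def Cons)
      then show ?thesis using IH[of ys' "Node a b # zs"] Cons by (simp add: id_def del: enc_list.simps)
    qed (simp add: g_def[of _ "Node (Num 0) _"])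
  qed simp
  from this[of _ _ "[]"]
  have "right (fold g xs (Node (enc_list id ys) (Num 0))) = enc_list id (rev (map2 Node xs ys))" for xs ys
    by simp
  ultimately have "ptime (\<lambda>x. enc_list id (rev (map2 Node (K x) (L x))))" by simp
  from ptime_rev[OF this] show ?thesis by simp
qed

text \<open>Induction on \<open>k\<close> produces a program with \<open>k\<close> successive
  multiplications. With an uncapped exponent the result could have exponentially many bits; the
  constancy of the number of levels enters the running time here.\<close>

lemma ptime_power_min:
  assumes "ptime (\<lambda>x. Num (b x))" "ptime (\<lambda>x. Num (j x))"
  shows "ptime (\<lambda>x. Num (b x ^ min (j x) k))"
proof (induction k)
  case 0
  show ?case by (simp add: ptime_Num_const)
next
  case (Suc k)
  have "b x ^ min (j x) (Suc k) = b x ^ min (j x) k * (if k < j x then b x else 1)" for x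
    by (cases "k < j x") (auto simp: min_absorb1 min_absorb2 mult.commute)
  moreover have "ptime (\<lambda>x. Num (b x ^ min (j x) k * (if k < j x then b x else 1)))"
    by (intro ptime_mult Suc ptime_if_nat ptime_less ptime_Num_const assms)
  ultimately show ?case by simp
qed

lemmas ptime_intros =
  ptime_id ptime_Num_const ptime_Node ptime_left ptime_right ptime_num_of ptime_add ptime_mult
  ptime_less ptime_eq ptime_eq_nat ptime_is_node ptime_if ptime_if_list ptime_if_nat
  ptime_vlist ptime_Nil ptime_Cons ptime_append ptime_concat_map ptime_map ptime_filter
  ptime_sum_list ptime_length ptime_not ptime_conj ptime_disj ptime_Ball ptime_mem ptime_zip
  ptime_power_min

section \<open>Balanced maps as exact matchings\<close>

text \<open>The remainder modulo \<open>B\<close> is the lowest digit, and the quotient carries the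
  others.\<close>

lemma digits_unique:
  fixes a b :: "nat \<Rightarrow> nat"
  assumes "\<And>i. i < n \<Longrightarrow> a i < B" "\<And>i. i < n \<Longrightarrow> b i < B"
    and "(\<Sum>i<n. a i * B ^ i) = (\<Sum>i<n. b i * B ^ i)" "i < n"
  shows "a i = b i"
  using assms
proof (induction n arbitrary: a b i)
  case (Suc n)
  have *: "(\<Sum>i<Suc n. f i * B ^ i) = f 0 + B * (\<Sum>i<n. f (Suc i) * B ^ i)" for f
    by (subst sum.lessThan_Suc_shift) (simp add: sum_distrib_left mult_ac)
  from Suc.prems(3) have eq: "a 0 + B * (\<Sum>i<n. a (Suc i) * B ^ i) = b 0 + B * (\<Sum>i<n. b (Suc i) * B ^ i)"
    unfolding * .
  have lt: "a 0 < B" "b 0 < B" using Suc.prems(1,2) by simp_all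
  have "a 0 = b 0"
    using arg_cong[OF eq, of "\<lambda>x. x mod B"] lt by simp
  moreover have "(\<Sum>i<n. a (Suc i) * B ^ i) = (\<Sum>i<n. b (Suc i) * B ^ i)"
    using arg_cong[OF eq, of "\<lambda>x. x div B"] lt by simp
  then have "a (Suc j) = b (Suc j)" if "j < n" for j
    using Suc.IH[of "\<lambda>i. a (Suc i)" "\<lambda>i. b (Suc i)" j] Suc.prems(1,2) that by simp
  ultimately show ?case using Suc.prems(4) by (cases i) auto
qed simp

text \<open>Grouped by exponent, the sum is a number in base \<open>B\<close> whose digits are the
  sizes of the fibres; these are at most \<open>card T < B\<close>.\<close>

lemma sum_powers_eq_imp_card_eq:
  fixes f g :: "'a \<Rightarrow> nat"
  assumes "finite T" "card T < B" "(\<Sum>t\<in>T. B ^ f t) = (\<Sum>t\<in>T. B ^ g t)"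
  shows "card {t \<in> T. f t = j} = card {t \<in> T. g t = j}"
proof -
  \<comment> \<open>Any length beyond all exponents will do; \<open>j\<close> is included so that it
    is a digit position even if both of its fibres are empty.\<close>
  define n where "n = Suc (Max (insert j (f ` T \<union> g ` T)))"
  have n: "j < n" "f ` T \<subseteq> {..<n}" "g ` T \<subseteq> {..<n}"
    using assms(1) by (auto simp: n_def less_Suc_eq_le)
  have *: "(\<Sum>i<n. card {t \<in> T. h t = i} * B ^ i) = (\<Sum>t\<in>T. B ^ h t)" if "h ` T \<subseteq> {..<n}" for h
  proof -
    have "(\<Sum>i<n. card {t \<in> T. h t = i} * B ^ i) = (\<Sum>i<n. \<Sum>t\<in>{t \<in> T. h t = i}. B ^ h t)"
      by (intro sum.cong) auto
    also have "\<dots> = (\<Sum>t\<in>T. B ^ h t)"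
      by (rule sum.group) (use assms(1) that in auto)
    finally show ?thesis .
  qed
  have le: "card {t \<in> T. h t = i} < B" for h :: "'a \<Rightarrow> nat" and i
    using card_mono[OF assms(1), of "{t \<in> T. h t = i}"] assms(2) by auto
  show ?thesis
    by (rule digits_unique[OF le le _ n(1)]) (simp add: * n assms(3))
qed

section \<open>Perfect matchings as bijections between the colour classes\<close>

lemma perfect_matching_bij:
  assumes AB: "A \<inter> B = {}" and E: "\<And>e. e \<in> E \<Longrightarrow> \<exists>a\<in>A. \<exists>b\<in>B. e = {a, b}"
    and M: "perfect_matching (A \<union> B) E M"
  shows "\<exists>\<phi>. bij_betw \<phi> A B \<and> M = (\<lambda>a. {a, \<phi> a}) ` A"
proof -
  have ME: "M \<subseteq> E" and ex1: "\<And>v. v \<in> A \<union> B \<Longrightarrow> \<exists>!e. e \<in> M \<and> v \<in> e"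
    using M by (auto simp: perfect_matching_def)
  have "\<exists>b\<in>B. {a, b} \<in> M" if "a \<in> A" for a
  proof -
    from ex1[of a] that obtain e where "e \<in> M" "a \<in> e" by auto
    then show ?thesis using E[of e] ME that AB by auto
  qed
  then obtain \<phi> where \<phi>: "\<And>a. a \<in> A \<Longrightarrow> \<phi> a \<in> B" "\<And>a. a \<in> A \<Longrightarrow> {a, \<phi> a} \<in> M"
    by metis
  have uniq: "e = e'" if "e \<in> M" "e' \<in> M" "v \<in> e" "v \<in> e'" "v \<in> A \<union> B" for e e' v
    using ex1[OF that(5)] that by blast
  have "inj_on \<phi> A"
  proof (rule inj_onI)
    fix a a' assume a: "a \<in> A" "a' \<in> A" "\<phi> a = \<phi> a'"
    have "{a, \<phi> a} = {a', \<phi> a'}"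
      by (rule uniq[of _ _ "\<phi> a"]) (use \<phi>(1)[of a] \<phi>(2)[of a] \<phi>(2)[of a'] a in auto)
    then show "a = a'" using a by (auto simp: doubleton_eq_iff)
  qed
  moreover have sub: "M \<subseteq> (\<lambda>a. {a, \<phi> a}) ` A"
  proof
    fix e assume "e \<in> M"
    with ME E[of e] obtain a b where ab: "a \<in> A" "b \<in> B" "e = {a, b}" by blast
    have "e = {a, \<phi> a}" by (rule uniq[of _ _ a]) (use ab \<phi> \<open>e \<in> M\<close> in auto)
    with ab show "e \<in> (\<lambda>a. {a, \<phi> a}) ` A" by blast
  qed
  moreover have "b \<in> \<phi> ` A" if "b \<in> B" for b
  proof -
    from ex1[of b] that obtain e where "e \<in> M" "b \<in> e" by auto
    with sub show ?thesis using that AB by auto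
  qed
  ultimately show ?thesis using \<phi> by (intro exI[of _ \<phi>]) (auto simp: bij_betw_def)
qed

lemma bij_perfect_matching:
  assumes AB: "A \<inter> B = {}" and \<phi>: "bij_betw \<phi> A B" "\<And>a. a \<in> A \<Longrightarrow> {a, \<phi> a} \<in> E"
  shows "perfect_matching (A \<union> B) E ((\<lambda>a. {a, \<phi> a}) ` A)"
proof -
  have \<phi>B: "\<phi> a \<in> B" if "a \<in> A" for a using \<phi> that by (auto simp: bij_betw_def)
  have inj: "a = a'" if "\<phi> a = \<phi> a'" "a \<in> A" "a' \<in> A" for a a'
    using \<phi>(1) that by (auto simp: bij_betw_def inj_on_def)
  have "\<exists>!e. e \<in> (\<lambda>a. {a, \<phi> a}) ` A \<and> v \<in> e" if "v \<in> A \<union> B" for v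
  proof (cases "v \<in> A")
    case True
    then show ?thesis by (intro ex1I[of _ "{v, \<phi> v}"]) (use \<phi>B AB in auto)
  next
    case False
    with that \<phi>(1) obtain a where "a \<in> A" "v = \<phi> a" by (auto simp: bij_betw_def)
    then show ?thesis by (intro ex1I[of _ "{a, \<phi> a}"]) (use False inj in auto)
  qed
  with \<phi>(2) show ?thesis by (auto simp: perfect_matching_def)
qed

text \<open>
  The six kinds of vertices: 0 treatments, 1 slots, 2 controls, 3 copies of controls, and
  4 and 5 the ends of the padding edges.
\<close>

definition vx :: "nat \<Rightarrow> nat \<Rightarrow> nat" where
  "vx i a = 6 * a + i"

lemma vx_eq_iff [simp]: "i < 6 \<Longrightarrow> j < 6 \<Longrightarrow> vx i a = vx j b \<longleftrightarrow> i = j \<and> a = b"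
  unfolding vx_def by presburger

lemma vx_div [simp]: "i < 6 \<Longrightarrow> vx i a div 6 = a"
  and vx_mod [simp]: "i < 6 \<Longrightarrow> vx i a mod 6 = i"
  unfolding vx_def by presburger+

section \<open>The weighted bipartite graph of an instance\<close>

locale bm_reduction =
  fixes I :: bm_instance and ts cs :: "nat list"
  assumes wf: "bm_wf I"
    and ts: "distinct ts" "set ts = treatments I"
    and cs: "distinct cs" "set cs = controls I"
begin

abbreviation "T \<equiv> treatments I"
abbreviation "C \<equiv> controls I"

text \<open>An upper bound for the cost of every map into the controls that a single pass over the
  distance matrix computes.\<close>

definition N :: nat where
  "N = (\<Sum>t\<leftarrow>ts. \<Sum>c\<leftarrow>cs. distance I t c)"

definition base :: nat where
  "base = Suc (length ts)"

definition edge_weight :: "nat \<Rightarrow> nat \<Rightarrow> nat" where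
  "edge_weight t c = distance I t c + Suc N * base ^ clevel I 2 c"

text \<open>
  \<open>N + 1\<close> isolated padding edges: the weights have to be polynomial in the size of the graph, whereas the
  distances are only bounded in terms of the length of the encoding.
\<close>

definition pads :: "nat list" where
  "pads = rev [0..<Suc N]"

definition vertex_list :: "nat list" where
  "vertex_list = map (vx 0) ts @ map (vx 1) ts @ map (vx 2) cs @ map (vx 3) cs @ map (vx 4) pads @
      map (vx 5) pads"

definition edge_list :: "(nat \<times> nat \<times> nat) list" where
  "edge_list =
     map (\<lambda>(t, c). (vx 0 t, vx 2 c, edge_weight t c)) (List.product ts cs) @
     map (\<lambda>(c, c'). (vx 3 c, vx 2 c', 0))
       (filter (\<lambda>(c, c'). clevel I 1 c = clevel I 1 c') (List.product cs cs)) @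
     map (\<lambda>(c, t). (vx 3 c, vx 1 t, 0))
       (filter (\<lambda>(c, t). clevel I 1 c = tlevel I 1 t) (List.product cs ts)) @
     map (\<lambda>i. (vx 4 i, vx 5 i, 0)) pads"

definition goal :: "nat \<Rightarrow> nat" where
  "goal d = d + Suc N * (\<Sum>t\<leftarrow>ts. base ^ tlevel I 2 t)"

definition ends :: "nat \<times> nat \<times> nat \<Rightarrow> nat set" where
  "ends = (\<lambda>(u, v, w). {u, v})"

text \<open>Weights belong to unordered pairs, while the list stores ordered triples. The lookup is
  unambiguous by \<open>distinct_ends\<close>.\<close>

definition wt :: "nat set \<Rightarrow> nat" where
  "wt e = the (map_of (map (\<lambda>(u, v, w). ({u, v}, w)) edge_list) e)"

definition G :: "nat \<Rightarrow> wem_instance" where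
  "G d = \<lparr>verts = set vertex_list, edges = ends ` set edge_list, weight = wt, target = goal d\<rparr>"

text \<open>The two colour classes, of equal size. Slots are on the side of the controls, since the
  copies choose between slots and controls.\<close>

definition A :: "nat set" where "A = vx 0 ` T \<union> vx 3 ` C \<union> vx 4 ` {..N}"
definition B :: "nat set" where "B = vx 2 ` C \<union> vx 1 ` T \<union> vx 5 ` {..N}"

lemma finite_T [simp]: "finite T" and finite_C [simp]: "finite C"
  using wf by (auto simp: bm_wf_def)

lemma set_pads [simp]: "set pads = {..N}"
  by (auto simp: pads_def)

lemma distinct_pads: "distinct pads"
  by (simp add: pads_def)

lemma set_vertex_list: "set vertex_list = A \<union> B"
  by (auto simp: vertex_list_def A_def B_def ts cs)

lemma A_B_disjoint: "A \<inter> B = {}"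
  by (auto simp: A_def B_def)

lemma distinct_vertex_list: "distinct vertex_list"
  using ts(1) cs(1) distinct_pads by (auto simp: vertex_list_def distinct_map inj_on_def)

lemma set_edge_list: "set edge_list =
    (\<lambda>(t, c). (vx 0 t, vx 2 c, edge_weight t c)) ` (T \<times> C) \<union>
    (\<lambda>(c, c'). (vx 3 c, vx 2 c', 0)) ` {(c, c') \<in> C \<times> C. clevel I 1 c = clevel I 1 c'} \<union>
    (\<lambda>(c, t). (vx 3 c, vx 1 t, 0)) ` {(c, t) \<in> C \<times> T. clevel I 1 c = tlevel I 1 t} \<union>
    (\<lambda>i. (vx 4 i, vx 5 i, 0)) ` {..N}"
  by (auto simp: edge_list_def ts cs)

lemma edge_list_bipartite: "(u, v, w) \<in> set edge_list \<Longrightarrow> u \<in> A \<and> v \<in> B"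
  by (auto simp: set_edge_list A_def B_def)

text \<open>The first end of a listed edge lies in \<open>A\<close> and the second in
  \<open>B\<close>; as these are disjoint, the unordered pair determines the ordered one.\<close>

lemma distinct_ends: "distinct (map ends edge_list)"
proof -
  have "distinct (map (\<lambda>(u, v, w). (u, v)) edge_list)"
    using ts(1) cs(1) distinct_pads
    by (auto simp: edge_list_def o_def case_prod_unfold distinct_map inj_on_def distinct_product)
  moreover have "inj_on (\<lambda>(u, v). {u, v}) (set (map (\<lambda>(u, v, w). (u, v)) edge_list))"
  proof -
    have "set (map (\<lambda>(u, v, w). (u, v)) edge_list) \<subseteq> A \<times> B"
      using edge_list_bipartite by fastforce
    moreover have "inj_on (\<lambda>(u, v). {u, v}) (A \<times> B)"
      using A_B_disjoint by (auto simp: inj_on_def doubleton_eq_iff)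
    ultimately show ?thesis by (rule inj_on_subset[rotated])
  qed
  ultimately have "distinct (map (\<lambda>(u, v). {u, v}) (map (\<lambda>(u, v, w). (u, v)) edge_list))"
    by (simp only: distinct_map simp_thms)
  then show ?thesis by (simp add: ends_def o_def case_prod_unfold)
qed

lemma wt_edge: "(u, v, w) \<in> set edge_list \<Longrightarrow> wt {u, v} = w"
proof -
  assume *: "(u, v, w) \<in> set edge_list"
  have "map fst (map (\<lambda>(u, v, w). ({u, v}, w)) edge_list) = map ends edge_list"
    by (simp add: ends_def case_prod_unfold)
  with distinct_ends have "distinct (map fst (map (\<lambda>(u, v, w). ({u, v}, w)) edge_list))"
    by (simp only:)
  then have "map_of (map (\<lambda>(u, v, w). ({u, v}, w)) edge_list) {u, v} = Some w"
    by (rule map_of_is_SomeI) (use * in force)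
  then show ?thesis by (simp add: wt_def)
qed

lemma edges_G_iff: "e \<in> ends ` set edge_list \<longleftrightarrow>
    (\<exists>t\<in>T. \<exists>c\<in>C. e = {vx 0 t, vx 2 c}) \<or>
    (\<exists>c\<in>C. \<exists>c'\<in>C. clevel I 1 c' = clevel I 1 c \<and> e = {vx 3 c, vx 2 c'}) \<or>
    (\<exists>c\<in>C. \<exists>t\<in>T. tlevel I 1 t = clevel I 1 c \<and> e = {vx 3 c, vx 1 t}) \<or>
    (\<exists>i\<le>N. e = {vx 4 i, vx 5 i})"
proof -
  have "ends ` set edge_list =
    (\<lambda>(t, c). {vx 0 t, vx 2 c}) ` (T \<times> C) \<union>
    (\<lambda>(c, c'). {vx 3 c, vx 2 c'}) ` {(c, c') \<in> C \<times> C. clevel I 1 c = clevel I 1 c'} \<union>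
    (\<lambda>(c, t). {vx 3 c, vx 1 t}) ` {(c, t) \<in> C \<times> T. clevel I 1 c = tlevel I 1 t} \<union>
    (\<lambda>i. {vx 4 i, vx 5 i}) ` {..N}"
    unfolding set_edge_list image_Un image_image by (simp add: ends_def case_prod_unfold)
  moreover have "y \<in> (\<lambda>(a, b). f a b) ` (X \<times> Y) \<longleftrightarrow> (\<exists>a\<in>X. \<exists>b\<in>Y. y = f a b)"
    for y :: "nat set" and f and X Y :: "nat set" by auto
  moreover have "y \<in> (\<lambda>(a, b). f a b) ` {(a, b) \<in> X \<times> Y. g a = h b} \<longleftrightarrow>
      (\<exists>a\<in>X. \<exists>b\<in>Y. h b = g a \<and> y = f a b)"
    for y :: "nat set" and f X Y and g h :: "nat \<Rightarrow> nat" by auto metis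
  moreover have "y \<in> f ` {..N} \<longleftrightarrow> (\<exists>i\<le>N. y = f i)" for y :: "nat set" and f by auto
  ultimately show ?thesis by (simp only: Un_iff disj_assoc)
qed

lemma edges_G:
  "{vx 0 t, v} \<in> ends ` set edge_list \<longleftrightarrow> t \<in> T \<and> v \<in> vx 2 ` C"
  "{vx 3 c, v} \<in> ends ` set edge_list \<longleftrightarrow> c \<in> C \<and>
     (v \<in> vx 2 ` {c' \<in> C. clevel I 1 c' = clevel I 1 c} \<or> v \<in> vx 1 ` {t \<in> T. tlevel I 1 t = clevel I 1 c})"
  "{vx 4 i, v} \<in> ends ` set edge_list \<longleftrightarrow> i \<le> N \<and> v = vx 5 i"
  unfolding edges_G_iff doubleton_eq_iff by auto

lemma wt_G:
  assumes "t \<in> T" "c \<in> C"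
  shows "wt {vx 0 t, vx 2 c} = edge_weight t c"
  by (rule wt_edge) (use assms in \<open>force simp: set_edge_list\<close>)

lemma wt_zero:
  assumes "a \<in> vx 3 ` C \<union> vx 4 ` {..N}" "{a, b} \<in> ends ` set edge_list"
  shows "wt {a, b} = 0"
proof -
  from assms(2) obtain u v w where uvw: "(u, v, w) \<in> set edge_list" "{a, b} = {u, v}"
    by (auto simp: ends_def)
  with assms(1) have "w = 0" by (auto simp: set_edge_list doubleton_eq_iff)
  with wt_edge[OF uvw(1)] uvw(2) show ?thesis by simp
qed

lemma tlevel_range: "t \<in> T \<Longrightarrow> p \<in> {1, 2} \<Longrightarrow> tlevel I p t \<in> {1..nlevels I p}"
  and clevel_range: "c \<in> C \<Longrightarrow> p \<in> {1, 2} \<Longrightarrow> clevel I p c \<in> {1..nlevels I p}"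
  using wf unfolding bm_wf_def tpart_def cpart_def by blast+

text \<open>Each vertex of \<open>A\<close> lies on one matching edge, and the edges at copies and
  paddings weigh nothing, so only the treatments contribute.\<close>

lemma sum_A:
  assumes "bij_betw \<phi> A B" "\<And>a. a \<in> A \<Longrightarrow> {a, \<phi> a} \<in> ends ` set edge_list"
    and "\<And>t. t \<in> T \<Longrightarrow> m t \<in> C \<and> \<phi> (vx 0 t) = vx 2 (m t)"
  shows "(\<Sum>e\<in>(\<lambda>a. {a, \<phi> a}) ` A. wt e) = bm_cost I m + Suc N * (\<Sum>t\<in>T. base ^ clevel I 2 (m t))"
proof -
  have "\<phi> a \<in> B" if "a \<in> A" for a using assms(1) that by (auto simp: bij_betw_def)
  then have "inj_on (\<lambda>a. {a, \<phi> a}) A"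
    using A_B_disjoint by (auto simp: inj_on_def doubleton_eq_iff)
  then have "(\<Sum>e\<in>(\<lambda>a. {a, \<phi> a}) ` A. wt e) = (\<Sum>a\<in>A. wt {a, \<phi> a})"
    by (simp add: sum.reindex)
  also have "\<dots> = (\<Sum>a\<in>vx 0 ` T. wt {a, \<phi> a})"
    by (rule sum.mono_neutral_right) (use assms(2) wt_zero in \<open>auto simp: A_def\<close>)
  also have "\<dots> = (\<Sum>t\<in>T. wt {vx 0 t, \<phi> (vx 0 t)})"
    by (subst sum.reindex) (auto simp: inj_on_def)
  also have "\<dots> = (\<Sum>t\<in>T. edge_weight t (m t))"
    by (intro sum.cong refl) (use assms(3) wt_G in auto)
  also have "\<dots> = bm_cost I m + Suc N * (\<Sum>t\<in>T. base ^ clevel I 2 (m t))"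
    by (simp add: edge_weight_def bm_cost_def sum.distrib sum_distrib_left)
  finally show ?thesis .
qed

lemma N_eq: "N = (\<Sum>t\<in>T. \<Sum>c\<in>C. distance I t c)"
  unfolding N_def using ts cs by (simp add: sum_list_distinct_conv_sum_set)

lemma cost_le_N:
  assumes "m ` T \<subseteq> C"
  shows "bm_cost I m \<le> N"
  unfolding N_eq bm_cost_def
  by (intro sum_mono member_le_sum) (use assms in auto)

lemma goal_eq: "goal d = d + Suc N * (\<Sum>t\<in>T. base ^ tlevel I 2 t)"
  unfolding goal_def using ts by (simp add: sum_list_distinct_conv_sum_set)

lemma card_T_less_base: "card T < base"
  using ts distinct_card[of ts] by (simp add: base_def)

lemma card_image_cpart:
  assumes "inj_on m T" "m ` T \<subseteq> C"
  shows "card (m ` T \<inter> cpart I p i) = card {t \<in> T. clevel I p (m t) = i}"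
proof -
  have "m ` T \<inter> cpart I p i = m ` {t \<in> T. clevel I p (m t) = i}"
    using assms(2) by (auto simp: cpart_def)
  moreover have "inj_on m {t \<in> T. clevel I p (m t) = i}"
    by (rule inj_on_subset[OF assms(1)]) auto
  ultimately show ?thesis by (simp add: card_image)
qed

lemma exact_matching_imp_feasible:
  assumes M: "exact_matching (G d) M" and d: "d \<le> N"
  shows "\<exists>m. bm_feasible I m \<and> bm_cost I m = d \<and>
    (\<forall>t\<in>T. \<forall>c\<in>C. {vx 0 t, vx 2 c} \<in> M \<longleftrightarrow> m t = c)"
proof -
  let ?E = "ends ` set edge_list"
  have pm: "perfect_matching (A \<union> B) ?E M" and w: "(\<Sum>e\<in>M. wt e) = goal d"
    using M by (simp_all add: exact_matching_def G_def set_vertex_list)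
  have "\<exists>a\<in>A. \<exists>b\<in>B. e = {a, b}" if "e \<in> ?E" for e
    using that edge_list_bipartite by (fastforce simp: ends_def)
  from perfect_matching_bij[OF A_B_disjoint this pm] obtain \<phi> where
    bij: "bij_betw \<phi> A B" and M_eq: "M = (\<lambda>a. {a, \<phi> a}) ` A" by blast
  have \<phi>E: "{a, \<phi> a} \<in> ?E" if "a \<in> A" for a
    using pm M_eq that by (auto simp: perfect_matching_def)
  have inj: "a = a'" if "\<phi> a = \<phi> a'" "a \<in> A" "a' \<in> A" for a a'
    using bij that by (auto simp: bij_betw_def inj_on_def)
  have "\<exists>c\<in>C. \<phi> (vx 0 t) = vx 2 c" if "t \<in> T" for t
    using \<phi>E[of "vx 0 t"] that by (auto simp: A_def edges_G)
  then obtain m where m: "\<And>t. t \<in> T \<Longrightarrow> m t \<in> C" "\<And>t. t \<in> T \<Longrightarrow> \<phi> (vx 0 t) = vx 2 (m t)"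
    by metis
  have mC: "m ` T \<subseteq> C" using m by auto
  have inj_m: "inj_on m T"
  proof (rule inj_onI)
    fix t t' assume "t \<in> T" "t' \<in> T" "m t = m t'"
    then have "vx 0 t = vx 0 t'" by - (rule inj, auto simp: m A_def)
    then show "t = t'" by simp
  qed
  have "(\<Sum>e\<in>M. wt e) = bm_cost I m + Suc N * (\<Sum>t\<in>T. base ^ clevel I 2 (m t))"
    unfolding M_eq by (rule sum_A[OF bij \<phi>E]) (use m in auto)
  with w have eq: "bm_cost I m + Suc N * (\<Sum>t\<in>T. base ^ clevel I 2 (m t)) =
    d + Suc N * (\<Sum>t\<in>T. base ^ tlevel I 2 t)"
    by (simp only: goal_eq)
  \<comment> \<open>Both numbers are remainders modulo \<open>N + 1\<close>; this is what
    \<open>d \<le> N\<close> is for.\<close>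
  have lt: "bm_cost I m < Suc N" "d < Suc N" using cost_le_N[OF mC] d by simp_all
  have cost: "bm_cost I m = d"
    using arg_cong[OF eq, of "\<lambda>x. x mod Suc N"] lt by (simp only: mod_mult_self2 mod_less)
  with eq have "(\<Sum>t\<in>T. base ^ clevel I 2 (m t)) = (\<Sum>t\<in>T. base ^ tlevel I 2 t)"
    by (simp only: add_left_cancel mult_cancel1) simp
  from sum_powers_eq_imp_card_eq[OF finite_T card_T_less_base this]
  have level2: "card (m ` T \<inter> cpart I 2 i) = card (tpart I 2 i)" for i
    unfolding card_image_cpart[OF inj_m mC] by (simp add: tpart_def)
  have level1: "card (m ` T \<inter> cpart I 1 i) = card (tpart I 1 i)" for i
  proof -
    let ?C = "cpart I 1 i" and ?T = "tpart I 1 i"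
    have fin: "finite ?C" "finite ?T" by (simp_all add: cpart_def tpart_def)
    \<comment> \<open>Forwards by the edges at a copy. Backwards by exclusion: a slot, or a control
      outside the image of \<open>m\<close>, is the partner neither of a treatment nor of a padding
      vertex, and the copy it is matched with has its level.\<close>
    have "\<phi> ` vx 3 ` ?C = vx 1 ` ?T \<union> vx 2 ` (?C - m ` T)"
    proof (intro equalityI subsetI)
      fix v assume "v \<in> \<phi> ` vx 3 ` ?C"
      then obtain c where c: "c \<in> C" "clevel I 1 c = i" "v = \<phi> (vx 3 c)" by (auto simp: cpart_def)
      from c have cA: "vx 3 c \<in> A" by (simp add: A_def)
      from \<phi>E[OF cA] c have "v \<in> vx 2 ` ?C \<union> vx 1 ` ?T"
        by (auto simp: edges_G cpart_def tpart_def)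
      moreover have "v \<noteq> vx 2 (m t)" if "t \<in> T" for t
      proof
        assume "v = vx 2 (m t)"
        then have "vx 3 c = vx 0 t" using that cA c(3) by - (rule inj, auto simp: m A_def)
        then show False by simp
      qed
      ultimately show "v \<in> vx 1 ` ?T \<union> vx 2 ` (?C - m ` T)" by blast
    next
      fix v assume v: "v \<in> vx 1 ` ?T \<union> vx 2 ` (?C - m ` T)"
      then have "v \<in> B" by (auto simp: B_def cpart_def tpart_def)
      then obtain a where a: "a \<in> A" "v = \<phi> a" using bij by (auto simp: bij_betw_def)
      from \<phi>E[OF a(1)] have aE: "{a, v} \<in> ?E" using a by simp
      from a(1) consider t where "t \<in> T" "a = vx 0 t" | c where "c \<in> C" "a = vx 3 c" | j where "a = vx 4 j"
        by (auto simp: A_def)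
      then show "v \<in> \<phi> ` vx 3 ` ?C"
      proof cases
        case 1
        then show ?thesis using v a m by auto
      next
        case 2
        then show ?thesis using v aE a by (auto simp: edges_G cpart_def tpart_def)
      next
        case 3
        then show ?thesis using v aE by (auto simp: edges_G)
      qed
    qed
    moreover have "inj_on \<phi> (vx 3 ` ?C)" by (rule inj_onI, rule inj) (auto simp: A_def cpart_def)
    then have "card (\<phi> ` vx 3 ` ?C) = card ?C"
      by (simp add: card_image inj_on_def)
    moreover have "card (vx 1 ` ?T \<union> vx 2 ` (?C - m ` T)) = card ?T + card (?C - m ` T)"
      by (subst card_Un_disjoint) (use fin in \<open>auto simp: card_image inj_on_def\<close>)
    moreover have "card ?C = card (?C \<inter> m ` T) + card (?C - m ` T)"
      using card_Un_disjoint[of "?C \<inter> m ` T" "?C - m ` T"] fin by (simp add: Int_Diff_Un Int_Diff_disjoint)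
    ultimately show ?thesis by (simp add: Int_commute)
  qed
  have "bm_feasible I m"
    unfolding bm_feasible_def using inj_m mC level1 level2 by auto
  moreover have "{vx 0 t, vx 2 c} \<in> M \<longleftrightarrow> m t = c" if "t \<in> T" "c \<in> C" for t c
  proof
    assume "{vx 0 t, vx 2 c} \<in> M"
    then obtain a where a: "a \<in> A" "{vx 0 t, vx 2 c} = {a, \<phi> a}" unfolding M_eq by auto
    have "vx 2 c \<notin> A" by (auto simp: A_def)
    with a have "a = vx 0 t" "\<phi> a = vx 2 c" by (auto simp: doubleton_eq_iff)
    with m(2)[OF that(1)] show "m t = c" by simp
  next
    assume "m t = c"
    then show "{vx 0 t, vx 2 c} \<in> M" unfolding M_eq using that m(2)[of t]
      by (intro image_eqI[of _ _ "vx 0 t"]) (auto simp: A_def)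
  qed
  ultimately show ?thesis using cost by blast
qed

lemma feasible_imp_exact_matching:
  assumes m: "bm_feasible I m"
  shows "\<exists>M. exact_matching (G (bm_cost I m)) M"
proof -
  let ?E = "ends ` set edge_list"
  have inj_m: "inj_on m T" and mC: "m ` T \<subseteq> C"
    and lev: "\<And>p i. p \<in> {1, 2} \<Longrightarrow> i \<in> {1..nlevels I p} \<Longrightarrow> card (m ` T \<inter> cpart I p i) = card (tpart I p i)"
    using m by (auto simp: bm_feasible_def)
  have "\<exists>f. bij_betw f (m ` T \<inter> cpart I 1 i) (tpart I 1 i)" if "i \<in> {1..nlevels I 1}" for i
    by (rule finite_same_card_bij) (use lev[of 1 i] that in \<open>auto simp: tpart_def\<close>)
  then obtain f where f: "\<And>i. i \<in> {1..nlevels I 1} \<Longrightarrow> bij_betw (f i) (m ` T \<inter> cpart I 1 i) (tpart I 1 i)"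
    by metis
  \<comment> \<open>The bijections of the single levels, glued along the level of the
    argument.\<close>
  define b where "b c = f (clevel I 1 c) c" for c
  have b: "b c \<in> T" "tlevel I 1 (b c) = clevel I 1 c" if "c \<in> m ` T" for c
  proof -
    have "clevel I 1 c \<in> {1..nlevels I 1}" using that mC by (intro clevel_range) auto
    from f[OF this] have "f (clevel I 1 c) ` (m ` T \<inter> cpart I 1 (clevel I 1 c)) = tpart I 1 (clevel I 1 c)"
      by (simp add: bij_betw_def)
    moreover have "c \<in> m ` T \<inter> cpart I 1 (clevel I 1 c)" using that mC by (auto simp: cpart_def)
    ultimately have "b c \<in> tpart I 1 (clevel I 1 c)" unfolding b_def by blast
    then show "b c \<in> T" "tlevel I 1 (b c) = clevel I 1 c" by (auto simp: tpart_def)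
  qed
  have inj_b: "c = c'" if "b c = b c'" "c \<in> m ` T" "c' \<in> m ` T" for c c'
  proof -
    have l: "clevel I 1 c' = clevel I 1 c" using b(2)[OF that(2)] b(2)[OF that(3)] that(1) by simp
    have "clevel I 1 c \<in> {1..nlevels I 1}" using that mC by (intro clevel_range) auto
    from f[OF this] have "inj_on (f (clevel I 1 c)) (m ` T \<inter> cpart I 1 (clevel I 1 c))"
      by (simp add: bij_betw_def)
    then show ?thesis
      by (rule inj_onD) (use that mC l in \<open>auto simp: b_def cpart_def\<close>)
  qed
  have surj_b: "t \<in> b ` m ` T" if "t \<in> T" for t
  proof -
    have "tlevel I 1 t \<in> {1..nlevels I 1}" using that by (intro tlevel_range) auto
    from f[OF this] have "f (tlevel I 1 t) ` (m ` T \<inter> cpart I 1 (tlevel I 1 t)) = tpart I 1 (tlevel I 1 t)"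
      by (simp add: bij_betw_def)
    moreover have "t \<in> tpart I 1 (tlevel I 1 t)" using that by (simp add: tpart_def)
    ultimately obtain c where "c \<in> m ` T" "c \<in> cpart I 1 (tlevel I 1 t)" "t = f (tlevel I 1 t) c"
      by blast
    then have "t = b c" by (simp add: b_def cpart_def)
    with \<open>c \<in> m ` T\<close> show ?thesis by blast
  qed
  \<comment> \<open>The residue modulo 6 is the kind of a vertex and the quotient its index. On
    \<open>A\<close> the last branch is reached by the padding vertices only.\<close>
  define \<phi> where "\<phi> x = (if x mod 6 = 0 then vx 2 (m (x div 6))
    else if x mod 6 = 3 then if x div 6 \<in> m ` T then vx 1 (b (x div 6)) else vx 2 (x div 6)
    else vx 5 (x div 6))" for x
  have \<phi>_simps: "\<phi> (vx 0 t) = vx 2 (m t)" "\<phi> (vx 4 i) = vx 5 i"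
    "\<phi> (vx 3 c) = (if c \<in> m ` T then vx 1 (b c) else vx 2 c)" for t i c
    by (simp_all add: \<phi>_def)
  have "inj_on \<phi> A"
  proof (rule inj_onI)
    fix a a' assume "a \<in> A" "a' \<in> A" "\<phi> a = \<phi> a'"
    then show "a = a'"
      unfolding A_def
      by (elim UnE imageE)
        (auto simp: \<phi>_simps dest: inj_onD[OF inj_m] inj_b split: if_split_asm)
  qed
  moreover have "\<phi> ` A = B"
  proof (intro equalityI subsetI)
    fix v assume "v \<in> \<phi> ` A"
    then show "v \<in> B" using mC b(1) by (auto simp: A_def B_def \<phi>_simps)
  next
    fix v assume "v \<in> B"
    then consider c where "c \<in> m ` T" "v = vx 2 c" | c where "c \<in> C" "c \<notin> m ` T" "v = vx 2 c"
      | t where "t \<in> T" "v = vx 1 t" | i where "i \<le> N" "v = vx 5 i"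
      unfolding B_def by blast
    then show "v \<in> \<phi> ` A"
    proof cases
      case 1
      then obtain t where "t \<in> T" "v = \<phi> (vx 0 t)" by (auto simp: \<phi>_simps)
      then show ?thesis by (auto simp: A_def)
    next
      case 2
      then have "v = \<phi> (vx 3 c)" "vx 3 c \<in> A" by (simp_all add: \<phi>_simps A_def)
      then show ?thesis by blast
    next
      case 3
      then obtain c where c: "c \<in> m ` T" "t = b c" using surj_b by blast
      then have "v = \<phi> (vx 3 c)" "c \<in> C" using 3 mC by (auto simp: \<phi>_simps)
      then show ?thesis by (auto simp: A_def)
    next
      case 4
      then have "v = \<phi> (vx 4 i)" "vx 4 i \<in> A" by (simp_all add: \<phi>_simps A_def)
      then show ?thesis by blast
    qed
  qed
  ultimately have bij: "bij_betw \<phi> A B" by (simp add: bij_betw_def)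
  have \<phi>E: "{a, \<phi> a} \<in> ?E" if "a \<in> A" for a
    using that mC b by (auto simp: A_def \<phi>_simps edges_G)
  let ?M = "(\<lambda>a. {a, \<phi> a}) ` A"
  have "perfect_matching (A \<union> B) ?E ?M"
    by (rule bij_perfect_matching[OF A_B_disjoint bij \<phi>E])
  moreover have "(\<Sum>e\<in>?M. wt e) = goal (bm_cost I m)"
  proof -
    \<comment> \<open>The power sum depends only on the counts per level, which feasibility equates
      on both sides.\<close>
    have "(\<Sum>t\<in>T. base ^ clevel I 2 (m t)) = (\<Sum>i\<in>{1..nlevels I 2}. \<Sum>t\<in>{t \<in> T. clevel I 2 (m t) =
        i}. base ^ clevel I 2 (m t))"
      by (rule sum.group[symmetric]) (use mC clevel_range[of _ 2] in auto)
    also have "\<dots> = (\<Sum>i\<in>{1..nlevels I 2}. card (tpart I 2 i) * base ^ i)"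
      using lev[of 2] by (intro sum.cong refl) (simp add: card_image_cpart[OF inj_m mC, symmetric])
    also have "\<dots> = (\<Sum>i\<in>{1..nlevels I 2}. \<Sum>t\<in>{t \<in> T. tlevel I 2 t = i}. base ^ tlevel I 2 t)"
      by (intro sum.cong) (auto simp: tpart_def)
    also have "\<dots> = (\<Sum>t\<in>T. base ^ tlevel I 2 t)"
      by (rule sum.group) (use tlevel_range[of _ 2] in auto)
    finally have "(\<Sum>t\<in>T. base ^ clevel I 2 (m t)) = (\<Sum>t\<in>T. base ^ tlevel I 2 t)" .
    with sum_A[OF bij \<phi>E, of m] mC show ?thesis by (auto simp: \<phi>_simps goal_eq)
  qed
  ultimately show ?thesis by (auto simp: exact_matching_def G_def set_vertex_list)
qed

end

section \<open>The reduction as a polynomial time function\<close>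

definition "treats x = vlist (left (right x))"
definition "ctrls x = vlist (left (right (right x)))"
definition "dist_rows x = vlist (right (right (right x)))"
definition "sample e = num_of (left e)"
definition "lev1 e = num_of (left (right e))"
definition "lev2 e = num_of (right (right e))"
definition "total_dist x = (\<Sum>r\<leftarrow>dist_rows x. \<Sum>v\<leftarrow>vlist r. num_of v)"
text \<open>The exponent is capped at the constant \<open>k\<close> in order to be polynomial time on malformed inputs, too.\<close>

definition "level_power k x j = (1 + length (treats x)) ^ min j k"
abbreviation "triple u v w \<equiv> enc_triple (u, v, w)"

text \<open>The paddings are an argument and are not computed from \<open>x\<close>: the total
  distance may be exponential in the size of an instance with large distances, and a list of that
  length cannot be built in polynomial time.\<close>

definition "vertex_vals x ps =
  map (\<lambda>e. Num (vx 0 (sample e))) (treats x) @ map (\<lambda>e. Num (vx 1 (sample e))) (treats x) @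
  map (\<lambda>e. Num (vx 2 (sample e))) (ctrls x) @ map (\<lambda>e. Num (vx 3 (sample e))) (ctrls x) @
  map (\<lambda>i. Num (vx 4 (num_of i))) (vlist ps) @ map (\<lambda>i. Num (vx 5 (num_of i))) (vlist ps)"

definition "edge_vals k x ps =
  concat (map (\<lambda>p. map (\<lambda>q. triple (vx 0 (sample (left p))) (vx 2 (sample (left q)))
       (num_of (right q) + (1 + total_dist x) * level_power k x (lev2 (left q))))
     (map2 Node (ctrls x) (vlist (right p)))) (map2 Node (treats x) (dist_rows x))) @
  concat (map (\<lambda>e. map (\<lambda>e'. triple (vx 3 (sample e)) (vx 2 (sample e')) 0)
     (filter (\<lambda>e'. lev1 e = lev1 e') (ctrls x))) (ctrls x)) @
  concat (map (\<lambda>e. map (\<lambda>e'. triple (vx 3 (sample e)) (vx 1 (sample e')) 0)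
     (filter (\<lambda>e'. lev1 e = lev1 e') (treats x))) (ctrls x)) @
  map (\<lambda>i. triple (vx 4 (num_of i)) (vx 5 (num_of i)) 0) (vlist ps)"

definition "goal_num k x d = num_of d + (1 + total_dist x) * (\<Sum>e\<leftarrow>treats x. level_power k x (lev2 e))"

definition "wem_val k z = (let x = left z; ps = left (right z); d = right (right z) in
  Node (enc_list id (vertex_vals x ps)) (Node (enc_list id (edge_vals k x ps)) (Num (goal_num k x d))))"

text \<open>Both orientations are looked up, since an answer may list an edge either way
  round.\<close>

definition "picked y e \<longleftrightarrow> Node (left e) (left (right e)) \<in> set (vlist (right y)) \<or>
  Node (left (right e)) (left e) \<in> set (vlist (right y))"

text \<open>Meant for arbitrary \<open>y\<close>. Only the edges of the graph are tested, so entries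
  of \<open>y\<close> that are not edges have no effect.\<close>

definition "valid_answer k x ps d y \<longleftrightarrow>
  (\<forall>v\<in>set (vertex_vals x ps).
     length (filter (\<lambda>e. picked y e \<and> (v = left e \<or> v = left (right e))) (edge_vals k x ps)) = 1) \<and>
  (\<Sum>e\<leftarrow>edge_vals k x ps. if picked y e then num_of (right (right e)) else 0) = goal_num k x d"

text \<open>The weight 0 is a dummy: \<open>picked\<close> looks at the endpoints only.\<close>

definition "extract x y =
  concat (map (\<lambda>e. map (\<lambda>e'. Node (Num (sample e)) (Num (sample e')))
    (filter (\<lambda>e'. picked y (triple (vx 0 (sample e)) (vx 2 (sample e')) 0)) (ctrls x))) (treats x))"

text \<open>A leaf reports a failed verification; a node is already an answer in the output format
  of the covariate problem.\<close>

definition "attempt k u = (let z = left u; x = left z; y = right u in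
  if valid_answer k x (left (right z)) (right (right z)) y
  then Node (Num 1) (enc_list id (extract x y)) else Num 0)"

section \<open>Polynomial time of the reduction and of the verification\<close>

lemma ptime_total_dist:
  assumes "ptime f"
  shows "ptime (\<lambda>x. Num (total_dist (f x)))"
  unfolding total_dist_def dist_rows_def by (intro ptime_intros assms)

lemma ptime_level_power:
  assumes "ptime f" "ptime (\<lambda>x. Num (j x))"
  shows "ptime (\<lambda>x. Num (level_power k (f x) (j x)))"
  unfolding level_power_def treats_def by (intro ptime_intros assms)

lemma ptime_triple:
  assumes "ptime (\<lambda>x. Num (u x))" "ptime (\<lambda>x. Num (v x))" "ptime (\<lambda>x. Num (w x))"
  shows "ptime (\<lambda>x. triple (u x) (v x) (w x))"
  unfolding enc_triple_def prod.case by (intro ptime_intros assms)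

lemma ptime_vertex_vals:
  assumes "ptime f" "ptime g"
  shows "ptime (\<lambda>x. enc_list id (vertex_vals (f x) (g x)))"
proof -
  have "ptime (\<lambda>z. enc_list id (vertex_vals (left z) (right z)))"
    unfolding vertex_vals_def treats_def ctrls_def sample_def vx_def by (intro ptime_intros)
  from ptime_compose[OF ptime_Node[OF assms] this] show ?thesis by simp
qed

lemma ptime_edge_vals:
  assumes "ptime f" "ptime g"
  shows "ptime (\<lambda>x. enc_list id (edge_vals k (f x) (g x)))"
proof -
  have "ptime (\<lambda>z. enc_list id (edge_vals k (left z) (right z)))"
    unfolding edge_vals_def treats_def ctrls_def dist_rows_def sample_def lev1_def lev2_def vx_def
    by (intro ptime_intros ptime_total_dist ptime_level_power ptime_triple)
  from ptime_compose[OF ptime_Node[OF assms] this] show ?thesis by simp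
qed

lemma ptime_goal_num:
  assumes "ptime f" "ptime g"
  shows "ptime (\<lambda>x. Num (goal_num k (f x) (g x)))"
proof -
  have "ptime (\<lambda>z. Num (goal_num k (left z) (right z)))"
    unfolding goal_num_def treats_def lev2_def
    by (intro ptime_intros ptime_total_dist ptime_level_power)
  from ptime_compose[OF ptime_Node[OF assms] this] show ?thesis by simp
qed

lemma ptime_wem_val: "ptime (wem_val k)"
  unfolding wem_val_def Let_def
  by (intro ptime_intros ptime_vertex_vals ptime_edge_vals ptime_goal_num)

lemma ptime_picked:
  assumes "ptime f" "ptime g"
  shows "ptime (\<lambda>x. of_truth (picked (f x) (g x)))"
  unfolding picked_def by (intro ptime_intros assms)

lemma ptime_attempt: "ptime (attempt k)"
  unfolding attempt_def Let_def valid_answer_def extract_def treats_def ctrls_def sample_def vx_def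
  by (intro ptime_intros ptime_vertex_vals ptime_edge_vals ptime_goal_num ptime_picked ptime_triple)

lemma map_filter_product:
  "map f (filter P (List.product xs ys)) =
     concat (map (\<lambda>x. map (\<lambda>y. f (x, y)) (filter (\<lambda>y. P (x, y)) ys)) xs)"
  by (induction xs) (auto simp: filter_map o_def)

lemma map_product:
  "map f (List.product xs ys) = concat (map (\<lambda>x. map (\<lambda>y. f (x, y)) ys) xs)"
  by (induction xs) auto

lemma card_Collect_eq_1_iff: "card {e. Q e} = 1 \<longleftrightarrow> (\<exists>!e. Q e)"
proof
  assume "card {e. Q e} = 1"
  then obtain e where "{e. Q e} = {e}" by (rule card_1_singletonE)
  then have "Q e" "\<And>e'. Q e' \<Longrightarrow> e' = e" by blast+
  then show "\<exists>!e. Q e" by (rule ex1I)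
next
  assume "\<exists>!e. Q e"
  then obtain e where "{e. Q e} = {e}" by blast
  then show "card {e. Q e} = 1" by simp
qed

text \<open>If the graph has \<open>S\<close> vertices and edges in total, then \<open>N + 1\<close>
  and \<open>n + 1\<close> are at most \<open>S\<close>, so a distance is at most \<open>S\<close>
  and the level term at most \<open>S * S ^ k\<close>.\<close>

definition weight_bound :: "nat \<Rightarrow> nat poly" where
  "weight_bound k = monom 1 1 + monom 1 (Suc k)"

section \<open>Correctness of the reduction on encoded instances\<close>

locale bm_input = bm_reduction +
  fixes k :: nat and x :: val
  assumes k: "nlevels I 2 = k"
    and x: "x = Node (enc_pair (nlevels I 1, nlevels I 2))
          (Node (enc_list (\<lambda>t. enc_triple (t, tlevel I 1 t, tlevel I 2 t)) ts)
            (Node (enc_list (\<lambda>c. enc_triple (c, clevel I 1 c, clevel I 2 c)) cs)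
              (enc_list (\<lambda>t. enc_list (\<lambda>c. Num (distance I t c)) cs) ts)))"
begin

definition ps :: val where "ps = enc_list Num pads"

lemma treats_x: "treats x = map (\<lambda>t. enc_triple (t, tlevel I 1 t, tlevel I 2 t)) ts"
  and ctrls_x: "ctrls x = map (\<lambda>c. enc_triple (c, clevel I 1 c, clevel I 2 c)) cs"
  and dist_rows_x: "dist_rows x = map (\<lambda>t. enc_list (\<lambda>c. Num (distance I t c)) cs) ts"
  by (simp_all add: treats_def ctrls_def dist_rows_def x)

lemma sample_simps [simp]:
  "sample (enc_triple (a, b, c)) = a" "lev1 (enc_triple (a, b, c)) = b" "lev2 (enc_triple (a, b, c)) = c"
  by (simp_all add: sample_def lev1_def lev2_def enc_triple_def)

lemma total_dist_x: "total_dist x = N"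
  by (simp add: total_dist_def dist_rows_x N_def o_def)

lemma level_power_t: "t \<in> T \<Longrightarrow> level_power k x (tlevel I 2 t) = base ^ tlevel I 2 t"
  and level_power_c: "c \<in> C \<Longrightarrow> level_power k x (clevel I 2 c) = base ^ clevel I 2 c"
  using tlevel_range[of t 2] clevel_range[of c 2]
  by (simp_all add: level_power_def base_def treats_x k min_absorb1)

lemma vertex_vals_x: "vertex_vals x ps = map Num vertex_list"
  by (simp add: vertex_vals_def vertex_list_def treats_x ctrls_x ps_def)

text \<open>\<open>List.product\<close> unfolds to nested maps. Zipping the treatments with the rows
  of the matrix, and the controls with the entries of a row, attaches to each pair its
  distance.\<close>

lemma edge_vals_x: "edge_vals k x ps = map enc_triple edge_list"
proof -
  have *: "concat (map (\<lambda>p. map (\<lambda>q. triple (vx 0 (sample (left p))) (vx 2 (sample (left q)))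
       (num_of (right q) + (1 + total_dist x) * level_power k x (lev2 (left q))))
     (map2 Node (ctrls x) (vlist (right p)))) (map2 Node (treats x) (dist_rows x))) =
    map enc_triple (map (\<lambda>(t, c). (vx 0 t, vx 2 c, edge_weight t c)) (List.product ts cs))"
    by (simp add: treats_x ctrls_x dist_rows_x zip_map_map zip_same_conv_map o_def map_product
        total_dist_x level_power_c cs(2)[symmetric] edge_weight_def map_concat
        cong: map_cong)
  show ?thesis
    unfolding edge_vals_def * edge_list_def map_append
    by (simp add: map_filter_product map_concat treats_x ctrls_x ps_def o_def filter_map)
qed

lemma goal_num_x: "goal_num k x (Num d) = goal d"
  by (simp add: goal_num_def goal_def total_dist_x treats_x o_def level_power_t ts(2)[symmetric]
      cong: map_cong)

definition inst :: "nat \<Rightarrow> val" where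
  "inst d = Node x (Node ps (Num d))"

lemma wem_val_inst: "wem_val k (inst d) =
  Node (enc_list Num vertex_list) (Node (enc_list enc_triple edge_list) (Num (goal d)))"
  by (simp add: wem_val_def inst_def vertex_vals_x edge_vals_x goal_num_x enc_list_map)

lemma wem_encodes_inst: "wem_encodes (G d) (wem_val k (inst d))"
proof -
  let ?es = "map (\<lambda>(u, v, w). (u, v)) edge_list"
  have "enumerates id vertex_list (verts (G d))"
    using distinct_vertex_list by (simp add: enumerates_def G_def)
  moreover have "map endpoints ?es = map ends edge_list"
    by (simp add: endpoints_def ends_def case_prod_unfold)
  then have "enumerates endpoints ?es (edges (G d))"
    using distinct_ends by (simp only: enumerates_def) (simp add: G_def)
  moreover have "enc_list enc_triple edge_list = enc_list (\<lambda>(u, v). enc_triple (u, v, weight (G d) {u,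
      v})) ?es"
  proof -
    have "map enc_triple edge_list = map (\<lambda>(u, v). enc_triple (u, v, weight (G d) {u, v})) ?es"
      by (auto simp: G_def wt_edge)
    then have "enc_list id (map enc_triple edge_list)
        = enc_list id (map (\<lambda>(u, v). enc_triple (u, v, weight (G d) {u, v})) ?es)"
      by (simp only:)
    then show ?thesis by (simp only: enc_list_map id_apply)
  qed
  ultimately show ?thesis
    unfolding wem_encodes_def wem_val_inst
    by (intro exI[of _ vertex_list] exI[of _ ?es]) (simp add: G_def)
qed

lemma weight_le:
  assumes "e \<in> edges (G d)"
  shows "weight (G d) e \<le> poly (weight_bound k) (card (verts (G d)) + card (edges (G d)))"
proof -
  let ?S = "card (verts (G d)) + card (edges (G d))"
  have "length vertex_list \<le> ?S"
    using distinct_card[OF distinct_vertex_list] by (simp add: G_def)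
  \<comment> \<open>The two padding blocks alone provide \<open>2 * (N + 1)\<close>
    vertices.\<close>
  then have S: "Suc N \<le> ?S" "base \<le> ?S"
    by (auto simp: vertex_list_def pads_def base_def)
  from assms obtain u v w where uvw: "(u, v, w) \<in> set edge_list" "e = {u, v}"
    by (auto simp: G_def ends_def)
  have "w \<le> ?S + ?S * ?S ^ k"
  proof (cases "w = 0")
    case False
    with uvw(1) obtain t c where tc: "t \<in> T" "c \<in> C" "w = edge_weight t c"
      by (auto simp: set_edge_list)
    have "distance I t c \<le> (\<Sum>c\<in>C. distance I t c)" by (rule member_le_sum) (use tc in auto)
    also have "\<dots> \<le> N" unfolding N_eq by (rule member_le_sum) (use tc in auto)
    finally have "distance I t c \<le> ?S" using S by simp
    moreover have "base ^ clevel I 2 c \<le> base ^ k"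
      using clevel_range[OF tc(2), of 2] by (intro power_increasing) (auto simp: k base_def)
    then have "Suc N * base ^ clevel I 2 c \<le> ?S * ?S ^ k"
      using S(2) by (intro mult_le_mono S(1)) (blast intro: le_trans power_mono zero_le)
    ultimately show ?thesis unfolding tc edge_weight_def by (rule add_mono)
  qed simp
  with wt_edge[OF uvw(1)] uvw(2) show ?thesis
    by (simp add: weight_bound_def poly_monom G_def)
qed

lemma inst_in_WEM: "(wem_val k (inst d), wem_answers (G d)) \<in> WEM (weight_bound k)"
proof -
  have "bipartite (verts (G d)) (edges (G d))"
    unfolding bipartite_def
  proof (intro exI conjI ballI)
    show "A \<union> B = verts (G d)" by (simp add: G_def set_vertex_list)
    fix e assume "e \<in> edges (G d)"
    then obtain u v w where "(u, v, w) \<in> set edge_list" "e = {u, v}" by (auto simp: G_def ends_def)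
    then show "\<exists>a\<in>A. \<exists>b\<in>B. e = {a, b}" using edge_list_bipartite by blast
  qed (rule A_B_disjoint)
  then show ?thesis
    unfolding WEM_def using wem_encodes_inst weight_le by (auto simp: G_def)
qed

definition selected :: "val \<Rightarrow> nat set set" where
  "selected y = ends ` {e \<in> set edge_list. picked y (enc_triple e)}"

lemma inj_on_ends: "inj_on ends (set edge_list)" and distinct_edge_list: "distinct edge_list"
  using distinct_ends by (simp_all add: distinct_map)

text \<open>The edge list has no repetitions and \<open>ends\<close> is injective on it, so counting
  list entries counts edges, and the sum over the list is the weight of the selected set.\<close>

lemma valid_answer_iff:
  "valid_answer k x ps (Num d) y \<longleftrightarrow> exact_matching (G d) (selected y)"
proof -
  let ?P = "\<lambda>e. picked y (enc_triple e)"
  have mem: "(Num v = left (enc_triple e) \<or> Num v = left (right (enc_triple e))) \<longleftrightarrow> v \<in> ends e" for v e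
    by (auto simp: enc_triple_def ends_def split: prod.splits)
  have 1: "length (filter (\<lambda>e. ?P e \<and> v \<in> ends e) edge_list) = 1 \<longleftrightarrow> (\<exists>!e. e \<in> selected y \<and> v \<in> e)" for v
  proof -
    let ?S = "{e \<in> set edge_list. ?P e \<and> v \<in> ends e}"
    have "length (filter (\<lambda>e. ?P e \<and> v \<in> ends e) edge_list) = card ?S"
      using distinct_card[OF distinct_filter[OF distinct_edge_list]] by simp
    also have "\<dots> = card (ends ` ?S)"
      by (rule card_image[symmetric]) (rule inj_on_subset[OF inj_on_ends], auto)
    also have "ends ` ?S = {e. e \<in> selected y \<and> v \<in> e}" by (auto simp: selected_def)
    finally show ?thesis by (simp only: card_Collect_eq_1_iff)
  qed
  have "(\<Sum>e\<leftarrow>edge_list. if ?P e then num_of (right (right (enc_triple e))) else 0) =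
      (\<Sum>e\<in>set edge_list. if ?P e then num_of (right (right (enc_triple e))) else 0)"
    by (rule sum_list_distinct_conv_sum_set[OF distinct_edge_list])
  also have "\<dots> = (\<Sum>e\<in>{e \<in> set edge_list. ?P e}. num_of (right (right (enc_triple e))))"
    by (simp add: sum.If_cases Int_def)
  also have "\<dots> = (\<Sum>e\<in>{e \<in> set edge_list. ?P e}. wt (ends e))"
    by (intro sum.cong refl) (auto simp: enc_triple_def ends_def wt_edge)
  also have "\<dots> = (\<Sum>e\<in>selected y. wt e)"
    unfolding selected_def by (subst sum.reindex) (auto intro: inj_on_subset[OF inj_on_ends])
  finally have 2: "(\<Sum>e\<leftarrow>edge_list. if ?P e then num_of (right (right (enc_triple e))) else 0) =
    (\<Sum>e\<in>selected y. wt e)" .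
  have "selected y \<subseteq> ends ` set edge_list" by (auto simp: selected_def)
  then show ?thesis
    unfolding valid_answer_def vertex_vals_x edge_vals_x goal_num_x
    by (simp add: filter_map o_def mem 1[simplified] 2 exact_matching_def perfect_matching_def G_def)
qed

lemma attempt_inst:
  "attempt k (Node (inst d) y) =
    (if exact_matching (G d) (selected y) then Node (Num 1) (enc_list id (extract x y)) else Num 0)"
  by (simp add: attempt_def inst_def valid_answer_iff)

text \<open>Soundness for an arbitrary \<open>y\<close>, wrong answers included: a verified
  \<open>y\<close> selects an exact matching, the matching determines \<open>m\<close>, and for each
  treatment \<open>t\<close> the filter in \<open>extract\<close> leaves exactly
  \<open>m t\<close>.\<close>

lemma attempt_cases:
  assumes "d \<le> N" "is_node (attempt k (Node (inst d) y))"
  shows "\<exists>m. bm_feasible I m \<and> bm_cost I m = d \<and>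
    attempt k (Node (inst d) y) = enc_some (enc_list (\<lambda>t. enc_pair (t, m t)) ts)"
proof -
  from assms(2) have ex: "exact_matching (G d) (selected y)"
    by (auto simp: attempt_inst split: if_splits)
  from exact_matching_imp_feasible[OF this assms(1)] obtain m where m: "bm_feasible I m" "bm_cost I m = d"
    "\<And>t c. t \<in> T \<Longrightarrow> c \<in> C \<Longrightarrow> {vx 0 t, vx 2 c} \<in> selected y \<longleftrightarrow> m t = c" by blast
  have pick: "picked y (triple (vx 0 t) (vx 2 c) 0) \<longleftrightarrow> m t = c" if "t \<in> T" "c \<in> C" for t c
  proof -
    have "picked y (triple (vx 0 t) (vx 2 c) 0) \<longleftrightarrow> {vx 0 t, vx 2 c} \<in> selected y"
    proof
      assume "picked y (triple (vx 0 t) (vx 2 c) 0)"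
      then have "picked y (enc_triple (vx 0 t, vx 2 c, edge_weight t c))"
        by (simp add: picked_def enc_triple_def)
      moreover have "(vx 0 t, vx 2 c, edge_weight t c) \<in> set edge_list"
        using that by (force simp: set_edge_list)
      ultimately show "{vx 0 t, vx 2 c} \<in> selected y"
        unfolding selected_def by (force simp: ends_def)
    next
      assume "{vx 0 t, vx 2 c} \<in> selected y"
      then obtain u v w where "picked y (enc_triple (u, v, w))" "{vx 0 t, vx 2 c} = {u, v}"
        by (auto simp: selected_def ends_def)
      then show "picked y (triple (vx 0 t) (vx 2 c) 0)"
        by (auto simp: picked_def enc_triple_def doubleton_eq_iff)
    qed
    with m(3)[OF that] show ?thesis by simp
  qed
  have "filter (\<lambda>c. picked y (triple (vx 0 t) (vx 2 c) 0)) cs = [m t]" if "t \<in> T" for t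
  proof -
    have "m t \<in> set cs" using m(1) that cs by (auto simp: bm_feasible_def)
    then have "filter (\<lambda>c. c = m t) cs = [m t]"
      using cs(1) by (induction cs) (auto simp: filter_empty_conv)
    moreover have "filter (\<lambda>c. picked y (triple (vx 0 t) (vx 2 c) 0)) cs = filter (\<lambda>c. c = m t) cs"
      by (rule filter_cong) (use pick that cs in auto)
    ultimately show ?thesis by simp
  qed
  then have "extract x y = concat (map (\<lambda>t. [enc_pair (t, m t)]) ts)"
    unfolding extract_def treats_x ctrls_x
    by (simp add: filter_map o_def enc_pair_def ts(2)[symmetric] cong: map_cong)
  then have "enc_list id (extract x y) = enc_list (\<lambda>t. enc_pair (t, m t)) ts"
    by (simp add: concat_map_singleton enc_list_map)
  with ex m show ?thesis by (auto simp: attempt_inst)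
qed

text \<open>Completeness for correct answers. The existence of \<open>M\<close> rules out
  \<open>enc_none\<close>; the reported matching may differ from \<open>M\<close>, and
  \<open>selected y\<close> recovers it.\<close>

lemma attempt_success:
  assumes "y \<in> wem_answers (G d)" "exact_matching (G d) M"
  shows "is_node (attempt k (Node (inst d) y))"
proof -
  from assms obtain es M' where y: "y = enc_some (enc_list enc_pair es)"
    and M': "exact_matching (G d) M'" "enumerates endpoints es M'"
    by (auto simp: wem_answers_def)
  have "picked y (enc_triple e) \<longleftrightarrow> ends e \<in> M'" for e
  proof -
    obtain u v w where e: "e = (u, v, w)" by (cases e)
    have "ends e \<in> M' \<longleftrightarrow> (\<exists>(a, b)\<in>set es. {u, v} = {a, b})"
      using M'(2) by (auto simp: enumerates_def endpoints_def ends_def e)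
    also have "\<dots> \<longleftrightarrow> (u, v) \<in> set es \<or> (v, u) \<in> set es"
      by (auto simp: doubleton_eq_iff)
    also have "\<dots> \<longleftrightarrow> picked y (enc_triple e)"
    proof -
      have "Node (Num a) (Num b) \<in> enc_pair ` set es \<longleftrightarrow> (a, b) \<in> set es" for a b
        by (force simp: enc_pair_def)
      then show ?thesis by (simp add: picked_def y e enc_triple_def)
    qed
    finally show ?thesis by simp
  qed
  then have "selected y = M'"
    using M'(1) by (auto simp: selected_def exact_matching_def perfect_matching_def G_def)
  with M'(1) show ?thesis by (simp add: attempt_inst)
qed

lemma bm_answers_enc:
  "bm_optimal I m \<Longrightarrow> enc_some (enc_list (\<lambda>t. enc_pair (t, m t)) ts) \<in> bm_answers I"
  using ts by (auto simp: bm_answers_def enumerates_def)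

end

section \<open>Randomized execution\<close>

text \<open>\<open>T\<close> and \<open>Q\<close> are guaranteed for all outcomes, \<open>R\<close>
  only with probability 2/3. Keeping the two apart allows sequential composition without a loss of
  probability.\<close>

definition run :: "com \<Rightarrow> state \<Rightarrow> nat \<Rightarrow> (state \<Rightarrow> bool) \<Rightarrow> (state \<Rightarrow> bool) \<Rightarrow> bool" where
  "run c s T Q R \<longleftrightarrow> (\<exists>\<mu>. exec c s \<mu> \<and> (\<forall>(s', t) \<in> set_pmf \<mu>. t \<le> T \<and> Q s') \<and>
     measure_pmf.prob \<mu> {(s', t). R s'} \<ge> 2 / 3)"

lemma prob_eq_1_if_sure:
  assumes "set_pmf \<mu> \<subseteq> E"
  shows "measure_pmf.prob \<mu> E = 1"
  using assms by (simp add: measure_pmf.prob_eq_1 AE_measure_pmf_iff subset_eq)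

lemma run_weaken:
  assumes "run c s T Q R" "T \<le> T'" "\<And>s'. Q s' \<Longrightarrow> Q' s'" "\<And>s'. Q s' \<Longrightarrow> R s' \<Longrightarrow> R' s'"
  shows "run c s T' Q' R'"
proof -
  from assms(1) obtain \<mu> where \<mu>: "exec c s \<mu>" "\<And>s' t. (s', t) \<in> set_pmf \<mu> \<Longrightarrow> t \<le> T \<and> Q s'"
    "measure_pmf.prob \<mu> {(s', t). R s'} \<ge> 2 / 3" unfolding run_def by blast
  have "measure_pmf.prob \<mu> {(s', t). R s'} = measure_pmf.prob \<mu> ({(s', t). R s'} \<inter> set_pmf \<mu>)"
    by (rule measure_Int_set_pmf[symmetric])
  also have "\<dots> \<le> measure_pmf.prob \<mu> {(s', t). R' s'}"
    by (rule measure_pmf.finite_measure_mono) (use \<mu>(2) assms(4) in auto)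
  finally show ?thesis unfolding run_def using \<mu> assms(2,3) by (force intro!: exI[of _ \<mu>] intro: le_trans)
qed

lemma run_sure:
  assumes "run c s T Q R" "\<And>s'. Q s' \<Longrightarrow> R' s'"
  shows "run c s T Q R'"
proof -
  from assms(1) obtain \<mu> where \<mu>: "exec c s \<mu>" "\<And>s' t. (s', t) \<in> set_pmf \<mu> \<Longrightarrow> t \<le> T \<and> Q s'"
    unfolding run_def by blast
  then have "measure_pmf.prob \<mu> {(s', t). R' s'} = 1"
    using assms(2) by (intro prob_eq_1_if_sure) auto
  with \<mu> show ?thesis unfolding run_def by (intro exI[of _ \<mu>]) auto
qed

lemma run_det:
  assumes "det_exec c s s' T" "Q s'" "R s'"
  shows "run c s T Q R"
proof -
  from assms(1) obtain t where t: "t \<le> T" "exec c s (return_pmf (s', t))"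
    unfolding det_exec_def by auto
  then show ?thesis unfolding run_def using assms(2,3)
    by (intro exI[of _ "return_pmf (s', t)"]) (auto simp: prob_eq_1_if_sure)
qed

text \<open>The continuations are chosen at once for all stores satisfying \<open>Q1\<close>; this
  is the part common to the two composition rules.\<close>

lemma run_Seq_aux:
  assumes c: "exec c s \<mu>" "\<And>s' t. (s', t) \<in> set_pmf \<mu> \<Longrightarrow> t \<le> T1 \<and> Q1 s'"
    and d: "\<And>s'. Q1 s' \<Longrightarrow> run d s' T2 Q R"
  shows "\<exists>\<nu>. exec (Seq c d) s (bind_pmf \<mu> (\<lambda>(s', t). tick t (\<nu> s'))) \<and>
    (\<forall>s'. Q1 s' \<longrightarrow> exec d s' (\<nu> s') \<and> measure_pmf.prob (\<nu> s') {(s'', t). R s''} \<ge> 2 / 3) \<and>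
    (\<forall>s' t. (s', t) \<in> set_pmf (bind_pmf \<mu> (\<lambda>(s', t). tick t (\<nu> s'))) \<longrightarrow> t \<le> T1 + T2 \<and> Q s')"
proof -
  from d have "\<forall>s'. \<exists>\<nu>. Q1 s' \<longrightarrow> exec d s' \<nu> \<and> (\<forall>(s'', t) \<in> set_pmf \<nu>. t \<le> T2 \<and> Q s'') \<and>
       measure_pmf.prob \<nu> {(s'', t). R s''} \<ge> 2 / 3"
    unfolding run_def by blast
  then obtain \<nu> where \<nu>: "\<And>s'. Q1 s' \<Longrightarrow> exec d s' (\<nu> s') \<and> (\<forall>(s'', t) \<in> set_pmf (\<nu> s'). t \<le> T2 \<and> Q s'') \<and>
       measure_pmf.prob (\<nu> s') {(s'', t). R s''} \<ge> 2 / 3" by metis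
  show ?thesis
  proof (intro exI conjI allI impI)
    show "exec (Seq c d) s (bind_pmf \<mu> (\<lambda>(s', t). tick t (\<nu> s')))"
      by (rule exec.Seq[OF c(1)]) (use c(2) \<nu> in blast)
    show "exec d s' (\<nu> s')" "measure_pmf.prob (\<nu> s') {(s'', t). R s''} \<ge> 2 / 3" if "Q1 s'" for s'
      using \<nu>[OF that] by blast+
    fix s' t assume "(s', t) \<in> set_pmf (bind_pmf \<mu> (\<lambda>(s', t). tick t (\<nu> s')))"
    then obtain s1 t1 t2 where "(s1, t1) \<in> set_pmf \<mu>" "(s', t2) \<in> set_pmf (\<nu> s1)" "t = t1 + t2"
      by (auto simp: tick_def)
    moreover from this c(2) have "t1 \<le> T1" "Q1 s1" by blast+
    moreover from this \<nu> \<open>(s', t2) \<in> _\<close> have "t2 \<le> T2" "Q s'" by blast+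
    ultimately show "t \<le> T1 + T2" "Q s'" by simp_all
  qed
qed

lemma prob_tick: "measure_pmf.prob (tick n \<mu>) {(s, t). R s} = measure_pmf.prob \<mu> {(s, t). R s}"
  unfolding tick_def measure_map_pmf by (rule arg_cong[of _ _ "measure_pmf.prob \<mu>"]) auto

text \<open>The second part carries the uncertainty: from every store reached its success
  probability is at least 2/3, and so is the average.\<close>

lemma run_Seq:
  assumes c: "run c s T1 Q1 R1" and d: "\<And>s'. Q1 s' \<Longrightarrow> run d s' T2 Q R"
  shows "run (Seq c d) s (T1 + T2) Q R"
proof -
  from c obtain \<mu> where \<mu>: "exec c s \<mu>" "\<And>s' t. (s', t) \<in> set_pmf \<mu> \<Longrightarrow> t \<le> T1 \<and> Q1 s'"
    unfolding run_def by blast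
  obtain \<nu> where \<nu>: "exec (Seq c d) s (bind_pmf \<mu> (\<lambda>(s', t). tick t (\<nu> s')))"
    "\<And>s'. Q1 s' \<Longrightarrow> exec d s' (\<nu> s')"
    "\<And>s'. Q1 s' \<Longrightarrow> measure_pmf.prob (\<nu> s') {(s'', t). R s''} \<ge> 2 / 3"
    "\<And>s' t. (s', t) \<in> set_pmf (bind_pmf \<mu> (\<lambda>(s', t). tick t (\<nu> s'))) \<Longrightarrow> t \<le> T1 + T2 \<and> Q s'"
    using run_Seq_aux[of c s \<mu> T1 Q1 d T2 Q R, OF \<mu> d] by blast
  let ?K = "\<lambda>(s', t). tick t (\<nu> s')"
  have "2 / 3 = measure_pmf.expectation \<mu> (\<lambda>_. 2 / 3 :: real)" by simp
  also have "\<dots> \<le> measure_pmf.expectation \<mu> (\<lambda>x. measure_pmf.prob (?K x) {(s', t). R s'})"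
    by (intro integral_mono_AE measure_pmf.integrable_const measure_pmf.integrable_const_bound[of _ 1])
      (use \<mu>(2) \<nu>(3) in \<open>auto simp: AE_measure_pmf_iff prob_tick\<close>)
  also have "\<dots> = measure_pmf.prob (bind_pmf \<mu> ?K) {(s', t). R s'}"
    by (simp add: measure_pmf_bind measure_pmf.measure_bind[where N = "count_space UNIV"]
        measure_pmf_in_subprob_algebra)
  finally show ?thesis unfolding run_def using \<nu>(1,4) by blast
qed

text \<open>The first part carries the uncertainty, and the second surely turns its success into
  \<open>R\<close>. Neither rule multiplies probabilities.\<close>

lemma run_Seq_first:
  assumes c: "run c s T1 Q1 R1" and d: "\<And>s'. Q1 s' \<Longrightarrow> run d s' T2 Q R'"
    and R: "\<And>s'. Q1 s' \<Longrightarrow> R1 s' \<Longrightarrow> run d s' T2 R R'"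
  shows "run (Seq c d) s (T1 + T2) Q R"
proof -
  from c obtain \<mu> where \<mu>: "exec c s \<mu>" "\<And>s' t. (s', t) \<in> set_pmf \<mu> \<Longrightarrow> t \<le> T1 \<and> Q1 s'"
    "measure_pmf.prob \<mu> {(s', t). R1 s'} \<ge> 2 / 3"
    unfolding run_def by blast
  obtain \<nu> where \<nu>: "exec (Seq c d) s (bind_pmf \<mu> (\<lambda>(s', t). tick t (\<nu> s')))"
    "\<And>s'. Q1 s' \<Longrightarrow> exec d s' (\<nu> s')"
    "\<And>s' t. (s', t) \<in> set_pmf (bind_pmf \<mu> (\<lambda>(s', t). tick t (\<nu> s'))) \<Longrightarrow> t \<le> T1 + T2 \<and> Q s'"
    using run_Seq_aux[of c s \<mu> T1 Q1 d T2 Q R', OF \<mu>(1,2) d] by blast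
  let ?K = "\<lambda>(s', t). tick t (\<nu> s')"
  \<comment> \<open>The second part has been described twice, with sure conclusion \<open>Q\<close>
    and with sure conclusion \<open>R\<close>; \<open>exec_unique\<close> identifies the two
    distributions.\<close>
  have sure: "measure_pmf.prob (\<nu> s') {(s'', t). R s''} = 1" if s': "Q1 s'" "R1 s'" for s'
  proof -
    from R[OF that] obtain \<nu>' where \<nu>': "exec d s' \<nu>'" "\<forall>(s'', t) \<in> set_pmf \<nu>'. R s''"
      unfolding run_def by blast
    with exec_unique[OF \<nu>(2)[OF s'(1)] \<nu>'(1)] show ?thesis by (intro prob_eq_1_if_sure) auto
  qed
  have "2 / 3 \<le> measure_pmf.prob \<mu> {(s', t). R1 s'}" by (rule \<mu>(3))
  also have "\<dots> = measure_pmf.expectation \<mu> (indicator {(s', t). R1 s'})" by simp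
  also have "\<dots> \<le> measure_pmf.expectation \<mu> (\<lambda>x. measure_pmf.prob (?K x) {(s', t). R s'})"
    by (intro integral_mono_AE measure_pmf.integrable_const_bound[of _ 1])
      (use \<mu>(2) sure in \<open>auto simp: AE_measure_pmf_iff prob_tick indicator_def\<close>)
  also have "\<dots> = measure_pmf.prob (bind_pmf \<mu> ?K) {(s', t). R s'}"
    by (simp add: measure_pmf_bind measure_pmf.measure_bind[where N = "count_space UNIV"]
        measure_pmf_in_subprob_algebra)
  finally show ?thesis unfolding run_def using \<nu>(1,3) by blast
qed

lemma run_Seq_det:
  assumes "det_exec c s s1 T1" "run d s1 T2 Q R"
  shows "run (Seq c d) s (T1 + T2) Q R"
  by (rule run_Seq[OF run_det[OF assms(1), of "\<lambda>s'. s' = s1" "\<lambda>_. True"]]) (use assms(2) in auto)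

lemma run_While:
  assumes "truth (eval s e)" "run (Seq c (While e c)) s T Q R"
  shows "run (While e c) s (1 + cost s e + T) Q R"
proof -
  from assms(2) obtain \<mu> where \<mu>: "exec (Seq c (While e c)) s \<mu>"
    "\<And>s' t. (s', t) \<in> set_pmf \<mu> \<Longrightarrow> t \<le> T \<and> Q s'" "measure_pmf.prob \<mu> {(s', t). R s'} \<ge> 2 / 3"
    unfolding run_def by blast
  from \<mu>(1) have "exec (While e c) s (tick (1 + cost s e) \<mu>)"
    by (cases rule: exec.cases) (auto intro: exec.WhileTrue[OF assms(1), simplified])
  moreover have "t \<le> 1 + cost s e + T \<and> Q s'" if "(s', t) \<in> set_pmf (tick (1 + cost s e) \<mu>)" for s' t
    using that \<mu>(2) by (auto simp: tick_def)
  ultimately show ?thesis unfolding run_def using \<mu>(3)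
    by (intro exI[of _ "tick (1 + cost s e) \<mu>"]) (auto simp: prob_tick)
qed

section \<open>Programs that solve a search problem with probability 2/3\<close>

definition solves :: "com \<Rightarrow> nat poly \<Rightarrow> problem \<Rightarrow> bool" where
  "solves c p P \<longleftrightarrow> (\<forall>(x, Y) \<in> P. \<exists>\<rho>. runs c x \<rho> \<and>
      (\<forall>(y, t) \<in> set_pmf \<rho>. t \<le> poly p (vsize x)) \<and>
      measure_pmf.prob \<rho> {(y, t). y \<in> Y} \<ge> 2 / 3)"

lemma rand_poly_time_iff: "rand_poly_time P \<longleftrightarrow> (\<exists>c p. solves c p P)"
  by (simp add: rand_poly_time_def solves_def)

text \<open>Without coin tosses the distribution is a point mass, so the probability of a correct
  answer is 0 or 1, and 2/3 forces correctness.\<close>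

lemma det_poly_time_iff: "det_poly_time P \<longleftrightarrow> (\<exists>c p. flip_free c \<and> solves c p P)"
proof -
  have "(\<exists>y t. runs c x (return_pmf (y, t)) \<and> t \<le> poly p (vsize x) \<and> y \<in> Y) \<longleftrightarrow>
      (\<exists>\<rho>. runs c x \<rho> \<and> (\<forall>(y, t) \<in> set_pmf \<rho>. t \<le> poly p (vsize x)) \<and>
        measure_pmf.prob \<rho> {(y, t). y \<in> Y} \<ge> 2 / 3)" (is "?L \<longleftrightarrow> ?R")
    if "flip_free c" for c p x Y
  proof -
    have prob: "measure_pmf.prob (return_pmf (y, t)) {(y, t). y \<in> Y} = of_bool (y \<in> Y)" for y and t :: nat
      by (simp add: indicator_def)
    show ?thesis
    proof
      assume ?L
      then obtain y t where "runs c x (return_pmf (y, t))" "t \<le> poly p (vsize x)" "y \<in> Y" by blast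
      then show ?R by (intro exI[of _ "return_pmf (y, t)"]) (simp add: prob)
    next
      assume ?R
      then obtain \<rho> where \<rho>: "runs c x \<rho>" "\<forall>(y, t) \<in> set_pmf \<rho>. t \<le> poly p (vsize x)"
        "measure_pmf.prob \<rho> {(y, t). y \<in> Y} \<ge> 2 / 3" by blast
      from \<rho>(1) obtain \<mu> where "exec c (init x) \<mu>" "\<rho> = map_pmf (\<lambda>(s, t). (s 0, t)) \<mu>"
        unfolding runs_def by blast
      with exec_flip_free[of c "init x" \<mu>] that obtain y t where yt: "\<rho> = return_pmf (y, t)"
        by (auto simp: map_return_pmf)
      with \<rho>(3) have "y \<in> Y" by (cases "y \<in> Y") (auto simp: indicator_def)
      with \<rho> yt show ?L by auto
    qed
  qed
  then show ?thesis unfolding det_poly_time_def solves_def by (simp cong: conj_cong)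
qed

text \<open>Of the answer only its size is known for sure. By \<open>exec_vsize\<close> the output
  has at most the size of the input plus twice the time; together with the time itself this gives
  the factor 3.\<close>

lemma run_Call:
  assumes c: "solves c p P" and P: "(eval s e, Y) \<in> P"
  shows "run (Call x c e) s (1 + cost s e + vsize (eval s e) + 3 * poly p (vsize (eval s e)))
    (\<lambda>s'. \<exists>y. vsize y \<le> vsize (eval s e) + 2 * poly p (vsize (eval s e)) \<and> s' = s(x := y))
    (\<lambda>s'. \<exists>y\<in>Y. s' = s(x := y))"
proof -
  let ?v = "eval s e"
  from c P obtain \<rho> where \<rho>: "runs c ?v \<rho>" "\<And>y t. (y, t) \<in> set_pmf \<rho> \<Longrightarrow> t \<le> poly p (vsize ?v)"
    "measure_pmf.prob \<rho> {(y, t). y \<in> Y} \<ge> 2 / 3" unfolding solves_def by blast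
  from \<rho>(1) obtain \<mu> where \<mu>: "exec c (init ?v) \<mu>" and \<rho>_eq: "\<rho> = map_pmf (\<lambda>(s, t). (s 0, t)) \<mu>"
    unfolding runs_def by blast
  let ?f = "\<lambda>(s', t). (s(x := s' 0), 1 + cost s e + t + vsize (s' 0))"
  have b: "t \<le> poly p (vsize ?v) \<and> vsize (s' 0) \<le> vsize ?v + 2 * poly p (vsize ?v)"
    if "(s', t) \<in> set_pmf \<mu>" for s' t
    using exec_vsize[OF \<mu> that, of 0] \<rho>(2)[of "s' 0" t] that by (force simp: \<rho>_eq init_def)
  have "2 / 3 \<le> measure_pmf.prob \<mu> ((\<lambda>(s, t). (s 0, t)) -` {(y, t). y \<in> Y})"
    using \<rho>(3) by (simp add: \<rho>_eq)
  also have "\<dots> \<le> measure_pmf.prob \<mu> (?f -` {(s', t). \<exists>y\<in>Y. s' = s(x := y)})"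
    by (rule measure_pmf.finite_measure_mono) auto
  finally have "measure_pmf.prob (map_pmf ?f \<mu>) {(s', t). \<exists>y\<in>Y. s' = s(x := y)} \<ge> 2 / 3"
    by simp
  moreover have "t \<le> 1 + cost s e + vsize ?v + 3 * poly p (vsize ?v) \<and>
     (\<exists>y. vsize y \<le> vsize ?v + 2 * poly p (vsize ?v) \<and> s' = s(x := y))"
    if st: "(s', t) \<in> set_pmf (map_pmf ?f \<mu>)" for s' t
  proof -
    from st obtain s1 t1 where "(s1, t1) \<in> set_pmf \<mu>" "s' = s(x := s1 0)" "t = 1 + cost s e + t1 +
        vsize (s1 0)"
      by auto
    with b[of s1 t1] show ?thesis by auto
  qed
  ultimately show ?thesis
    unfolding run_def using exec.Call[OF \<mu>, of x] by blast
qed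

section \<open>The search for the optimal cost\<close>

text \<open>Written as an explicit loop outside the framework of \<open>ptime\<close>, because the
  number of rounds is polynomial only under the bound on the distances. Counting up while adding at
  the front yields a descending list.\<close>

definition pad_loop :: com where
  "pad_loop = While (Less (Var 4) (Var 2))
     (Seq (Assign 3 (MkNode (Var 4) (Var 3))) (Assign 4 (Add (Var 4) (Const 1))))"

lemma vsize_countdown: "vsize (enc_list Num (rev [0..<n])) \<le> n * (n + 3) + 1"
proof (induction n)
  case 0
  show ?case using vsize_Num_bound[of 0] by (simp del: vsize.simps(1))
next
  case (Suc n)
  then show ?case using vsize_Num_bound[of n] by (simp add: algebra_simps del: vsize.simps(1))
qed

lemma det_exec_pad_loop:
  assumes "i \<le> n"
  shows "s 2 = Num n \<Longrightarrow> s 4 = Num i \<Longrightarrow> s 3 = enc_list Num (rev [0..<i]) \<Longrightarrow>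
    det_exec pad_loop s (s(3 := enc_list Num (rev [0..<n]), 4 := Num n))
      (Suc (n - i) * (30 + 10 * n + 5 * (n * (n + 3))))"
  using assms
proof (induction arbitrary: s rule: inc_induct)
  case base
  have "\<not> truth (eval s (Less (Var 4) (Var 2)))" using base by simp
  then have run: "det_exec pad_loop s s (1 + cost s (Less (Var 4) (Var 2)))"
    unfolding pad_loop_def by (rule det_exec_WhileFalse)
  have eq: "s(3 := enc_list Num (rev [0..<n]), 4 := Num n) = s"
    using base by (auto simp: fun_eq_iff)
  have "1 + cost s (Less (Var 4) (Var 2)) \<le> 30 + 10 * n + 5 * (n * (n + 3))"
    using base vsize_Num_bound[of n] vsize_of_truth[of False] by (simp del: vsize.simps(1))
  then show ?case unfolding eq by (intro det_exec_mono[OF run]) simp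
next
  case (step i)
  let ?K = "30 + 10 * n + 5 * (n * (n + 3))"
  let ?s = "s(3 := enc_list Num (rev [0..<Suc i]), 4 := Num (Suc i))"
  have t: "truth (eval s (Less (Var 4) (Var 2)))" using step by simp
  have "i * (i + 3) \<le> n * (n + 3)" using step by (intro mult_le_mono) auto
  then have sz: "vsize (enc_list Num (rev [0..<i])) \<le> n * (n + 3) + 1"
    using vsize_countdown[of i] by linarith
  have body: "det_exec (Seq (Assign 3 (MkNode (Var 4) (Var 3))) (Assign 4 (Add (Var 4) (Const 1)))) s ?s
    (1 + cost s (MkNode (Var 4) (Var 3)) + (1 + cost (s(3 := Node (Num i) (s 3))) (Add (Var 4) (Const 1))))"
    using det_exec_Seq[OF det_exec_Assign[of 3 "MkNode (Var 4) (Var 3)" s] det_exec_Assign[of 4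
        "Add (Var 4) (Const 1)"]] step
    by simp
  have cost: "1 + cost s (Less (Var 4) (Var 2)) + (1 + cost s (MkNode (Var 4) (Var 3)) +
      (1 + cost (s(3 := Node (Num i) (s 3))) (Add (Var 4) (Const 1)))) \<le> ?K"
    using step.prems step.hyps sz vsize_Num_bound[of n] vsize_Num_bound[of i] vsize_Num_bound[of "Suc i"]
      vsize_Num_bound[of 1] vsize_of_truth[of True]
    by (simp del: vsize.simps(1) upt_Suc)
  have "det_exec pad_loop ?s (?s(3 := enc_list Num (rev [0..<n]), 4 := Num n)) (Suc (n - Suc i) * ?K)"
    by (rule step.IH) (use step.prems in auto)
  moreover have "?s(3 := enc_list Num (rev [0..<n]), 4 := Num n) = s(3 := enc_list Num (rev [0..<n]),
      4 := Num n)"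
    by (simp add: fun_eq_iff)
  ultimately have rest: "det_exec pad_loop ?s (s(3 := enc_list Num (rev [0..<n]), 4 :=
      Num n)) (Suc (n - Suc i) * ?K)"
    by (simp only:)
  have eq: "Suc (n - i) * ?K = ?K + Suc (n - Suc i) * ?K" using step.hyps by (simp add: Suc_diff_Suc)
  show ?case unfolding eq
    by (rule det_exec_mono[OF det_exec_WhileTrue[OF t body rest[unfolded pad_loop_def],
        folded pad_loop_def]])
      (rule add_right_mono[OF cost])
qed

section \<open>The loop over all costs with an unreliable body\<close>

context
  fixes body :: com and K Z M :: nat and x ps :: val
    and Y :: "nat \<Rightarrow> val set" and upd :: "nat \<Rightarrow> val \<Rightarrow> val \<Rightarrow> val"
  assumes body: "\<And>s d rest. d < M \<Longrightarrow> s 1 = x \<Longrightarrow> s 3 = ps \<Longrightarrow> s 4 = Node (Num d) rest \<Longrightarrow>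
    vsize (s 4) \<le> Z \<Longrightarrow> run body s K
      (\<lambda>s'. s' 1 = x \<and> s' 3 = ps \<and> s' 4 = rest \<and> (\<exists>y. s' 0 = upd d (s 0) y))
      (\<lambda>s'. \<exists>y\<in>Y d. s' 0 = upd d (s 0) y)"
begin

text \<open>Describes the rounds below the optimum: no answer \<open>y\<close> can change the
  result, so it is kept with certainty.\<close>

lemma run_loop_idle:
  assumes "n \<le> M" "\<And>d r y. d < n \<Longrightarrow> upd d r y = r" "s 1 = x" "s 3 = ps"
    "s 4 = enc_list Num (rev [0..<n])" "vsize (s 4) \<le> Z"
  shows "run (While (IsNode (Var 4)) body) s (Suc n * (K + Z + 5)) (\<lambda>s'. s' 0 = s 0) (\<lambda>_. True)"
  using assms
proof (induction n arbitrary: s)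
  case 0
  have "\<not> truth (eval s (IsNode (Var 4)))" using 0 by simp
  moreover have "1 + cost s (IsNode (Var 4)) \<le> K + Z + 5"
    using 0 vsize_of_truth[of False] by simp
  ultimately show ?case
    by - (rule run_det[OF det_exec_mono[OF det_exec_WhileFalse]], auto)
next
  case (Suc n)
  have t: "truth (eval s (IsNode (Var 4)))" using Suc by simp
  have c: "1 + cost s (IsNode (Var 4)) \<le> Z + 5"
    using Suc.prems vsize_of_truth[of True] by simp
  have "run body s K (\<lambda>s'. s' 1 = x \<and> s' 3 = ps \<and> s' 4 = enc_list Num (rev [0..<n]) \<and>
      (\<exists>y. s' 0 = upd n (s 0) y)) (\<lambda>s'. \<exists>y\<in>Y n. s' 0 = upd n (s 0) y)"
    using Suc.prems by (intro body) auto
  then have "run (Seq body (While (IsNode (Var 4)) body)) s (K + Suc n * (K + Z + 5)) (\<lambda>s'. s' 0 =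
      s 0) (\<lambda>_. True)"
  proof (rule run_Seq)
    fix s' :: state assume s': "s' 1 = x \<and> s' 3 = ps \<and> s' 4 = enc_list Num (rev [0..<n]) \<and> (\<exists>y. s' 0 =
        upd n (s 0) y)"
    then have "s' 0 = s 0" using Suc.prems(2) by auto
    moreover have "run (While (IsNode (Var 4)) body) s' (Suc n * (K + Z + 5)) (\<lambda>s''. s'' 0 =
        s' 0) (\<lambda>_. True)"
      by (rule Suc.IH) (use Suc.prems s' in auto)
    ultimately show "run (While (IsNode (Var 4)) body) s' (Suc n * (K + Z + 5)) (\<lambda>s'. s' 0 =
        s 0) (\<lambda>_. True)"
      by simp
  qed
  from run_While[OF t this] show ?case by (rule run_weaken) (use c in auto)
qed

text \<open>Only the round for \<open>e\<close> is charged with the error. The rounds before it may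
  leave anything in variable 0, and those after it are idle.\<close>

lemma run_loop_success:
  assumes "n \<le> M" "e < n" "\<And>d r y. d < e \<Longrightarrow> upd d r y = r" "\<And>r y. y \<in> Y e \<Longrightarrow> upd e r y \<in> S"
    "s 1 = x" "s 3 = ps" "s 4 = enc_list Num (rev [0..<n])" "vsize (s 4) \<le> Z"
  shows "run (While (IsNode (Var 4)) body) s (Suc n * (K + Z + 5)) (\<lambda>_. True) (\<lambda>s'. s' 0 \<in> S)"
  using assms
proof (induction n arbitrary: s)
  case (Suc n)
  have t: "truth (eval s (IsNode (Var 4)))" using Suc by simp
  have c: "1 + cost s (IsNode (Var 4)) \<le> Z + 5"
    using Suc.prems vsize_of_truth[of True] by simp
  let ?W = "While (IsNode (Var 4)) body"
  have b: "run body s K (\<lambda>s'. s' 1 = x \<and> s' 3 = ps \<and> s' 4 = enc_list Num (rev [0..<n]) \<and>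
      (\<exists>y. s' 0 = upd n (s 0) y)) (\<lambda>s'. \<exists>y\<in>Y n. s' 0 = upd n (s 0) y)"
    using Suc.prems by (intro body) auto
  have "run (Seq body ?W) s (K + Suc n * (K + Z + 5)) (\<lambda>_. True) (\<lambda>s'. s' 0 \<in> S)"
  proof (cases "e = n")
    case True
    have idle: "run ?W s' (Suc n * (K + Z + 5)) (\<lambda>s''. s'' 0 = s' 0) (\<lambda>_. True)"
      if "s' 1 = x \<and> s' 3 = ps \<and> s' 4 = enc_list Num (rev [0..<n]) \<and> (\<exists>y. s' 0 = upd n (s 0) y)"
          for s' :: state
      by (rule run_loop_idle) (use Suc.prems True that in auto)
    show ?thesis
    proof (rule run_Seq_first[OF b, where R' = "\<lambda>_. True"])
      fix s' :: state assume s': "s' 1 = x \<and> s' 3 = ps \<and> s' 4 = enc_list Num (rev [0..<n]) \<and> (\<exists>y. s' 0 =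
          upd n (s 0) y)"
      show "run ?W s' (Suc n * (K + Z + 5)) (\<lambda>_. True) (\<lambda>_. True)"
        using idle[OF s'] by (rule run_weaken) auto
      assume "\<exists>y\<in>Y n. s' 0 = upd n (s 0) y"
      then have "s' 0 \<in> S" using Suc.prems(4) True by auto
      then show "run ?W s' (Suc n * (K + Z + 5)) (\<lambda>s'. s' 0 \<in> S) (\<lambda>_. True)"
        using idle[OF s'] by - (erule run_weaken, auto)
    qed
  next
    case False
    \<comment> \<open>A round above \<open>e\<close>: its success is ignored, as the induction
      hypothesis holds for any content of variable 0.\<close>
    show ?thesis
      by (rule run_Seq[OF b], rule Suc.IH) (use Suc.prems False in auto)
  qed
  from run_While[OF t this] show ?case by (rule run_weaken) (use c in auto)
qed simp

end

text \<open>
  Variables: 0 answer so far, 1 instance, 2 \<open>N + 1\<close>, 3 list of paddings, 4 costs still to be tried.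
\<close>

definition search_body :: "com \<Rightarrow> com \<Rightarrow> com \<Rightarrow> com" where
  "search_body ci c ca =
    Seq (Call 5 ci (MkNode (Var 1) (MkNode (Var 3) (Left (Var 4)))))
   (Seq (Call 6 c (Var 5))
   (Seq (Call 5 ca (MkNode (MkNode (Var 1) (MkNode (Var 3) (Left (Var 4)))) (Var 6)))
   (Seq (Cond (IsNode (Var 5)) (Assign 0 (Var 5)) (Assign 5 (Const 0)))
        (Assign 4 (Right (Var 4))))))"

definition search_prefix :: "com \<Rightarrow> com" where
  "search_prefix ct =
    Seq (Assign 1 (Var 0)) (Seq (Call 2 ct (Var 0)) (Seq (Assign 3 (Const 0)) (Seq (Assign 4 (Const 0))
   (Seq pad_loop (Seq (Assign 4 (Var 3)) (Assign 0 (Const 0)))))))"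

definition search :: "com \<Rightarrow> com \<Rightarrow> com \<Rightarrow> com \<Rightarrow> com" where
  "search ct ci c ca = Seq (search_prefix ct) (While (IsNode (Var 4)) (search_body ci c ca))"

text \<open>\<open>J\<close> bounds the encoded graph, \<open>L\<close> the answer of the matching
  algorithm, and \<open>Z\<close> the values kept between rounds. The summands follow the sequence
  of commands in the body.\<close>

definition body_time :: "nat poly \<Rightarrow> nat poly \<Rightarrow> nat poly \<Rightarrow> nat \<Rightarrow> nat" where
  "body_time p1 pc p2 Z = (let J = poly p1 (2 + 3 * Z); L = J + 2 * poly pc J in
     (20 + 20 * Z + 2 * J) + ((3 + 2 * J + 3 * poly pc J) +
     ((40 + 40 * Z + 2 * L + 2 * poly p2 (3 + 3 * Z + L)) + ((20 + 2 * poly p2 (3 + 3 * Z + L)) + (3 +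
         2 * Z)))))"

lemma poly_bounded_body_time: "poly_bounded T \<Longrightarrow> poly_bounded (\<lambda>n. body_time p1 pc p2 (T n))"
  unfolding body_time_def Let_def by (intro poly_bounded_intros)

lemma length_less_vsize: "length xs < vsize (enc_list f xs)"
  using vsize_ge_1[of "Num 0"] by (induction xs) (auto simp del: vsize.simps(1))

context bm_input
begin

text \<open>Coins can be tossed only in the call of \<open>c\<close>. What follows it is
  deterministic, so \<open>run_Seq_first\<close> transfers both what is sure and what is probable
  about the answer \<open>y\<close>.\<close>

lemma run_search_body:
  assumes ci: "computes ci (wem_val k) p1" and c: "solves c pc (WEM (weight_bound k))"
    and ca: "computes ca (attempt k) p2"
    and Z: "vsize x \<le> Z" "vsize ps \<le> Z"
    and s: "s 1 = x" "s 3 = ps" "s 4 = Node (Num d) rest" "vsize (s 4) \<le> Z"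
  shows "run (search_body ci c ca) s (body_time p1 pc p2 Z)
    (\<lambda>s'. s' 1 = x \<and> s' 3 = ps \<and> s' 4 = rest \<and> (\<exists>y. s' 0 =
      (if is_node (attempt k (Node (inst d) y)) then attempt k (Node (inst d) y) else s 0)))
    (\<lambda>s'. \<exists>y\<in>wem_answers (G d). s' 0 =
      (if is_node (attempt k (Node (inst d) y)) then attempt k (Node (inst d) y) else s 0))"
proof -
  let ?e = "MkNode (Var 1) (MkNode (Var 3) (Left (Var 4)))"
  define J where "J = poly p1 (2 + 3 * Z)"
  define L where "L = J + 2 * poly pc J"
  define H where "H = poly p2 (3 + 3 * Z + L)"
  define upd where "upd y = (if is_node (attempt k (Node (inst d) y)) then attempt k (Node (inst d) y)
      else s 0)" for y
  have sz: "vsize (Num d) \<le> Z" "vsize rest \<le> Z" "vsize (Node (Num d) rest) \<le> Z"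
    using s by simp_all
  have szi: "vsize (inst d) \<le> 2 + 3 * Z" using sz Z by (simp add: inst_def del: vsize.simps(1))
  have eval_e: "eval s' ?e = inst d" if "s' 1 = x" "s' 3 = ps" "s' 4 = Node (Num d) rest" for s'
    using that by (simp add: inst_def)
  have cost_e: "cost s' ?e \<le> 15 + 20 * Z" if "s' 1 = x" "s' 3 = ps" "s' 4 = Node (Num d) rest" for s'
    using that sz Z by (simp del: vsize.simps(1))
  define s1 where "s1 = s(5 := wem_val k (inst d))"
  have 1: "det_exec (Call 5 ci ?e) s s1 (20 + 20 * Z + 2 * J)"
  proof (rule det_exec_mono)
    show "det_exec (Call 5 ci ?e) s s1 (1 + cost s ?e + 2 * poly p1 (vsize (inst d)))"
      using det_exec_Call[OF ci, of 5 ?e s] unfolding eval_e[OF s(1,2,3)] s1_def .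
    show "1 + cost s ?e + 2 * poly p1 (vsize (inst d)) \<le> 20 + 20 * Z + 2 * J"
      using cost_e[of s] s poly_nat_mono[OF szi, of p1] unfolding J_def by linarith
  qed
  have szw: "vsize (wem_val k (inst d)) \<le> J"
    using ci poly_nat_mono[OF szi, of p1] unfolding computes_def J_def by (meson le_trans)
  have pcJ: "poly pc (vsize (wem_val k (inst d))) \<le> poly pc J" by (rule poly_nat_mono[OF szw])
  have "(eval s1 (Var 5), wem_answers (G d)) \<in> WEM (weight_bound k)"
    by (simp add: s1_def inst_in_WEM)
  from run_Call[OF c this, of 6]
  have 2: "run (Call 6 c (Var 5)) s1 (3 + 2 * J + 3 * poly pc J)
    (\<lambda>s'. \<exists>y. vsize y \<le> L \<and> s' = s1(6 := y)) (\<lambda>s'. \<exists>y\<in>wem_answers (G d). s' = s1(6 := y))"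
  proof (rule run_weaken)
    show "\<exists>y. vsize y \<le> L \<and> s' = s1(6 := y)"
      if "\<exists>y. vsize y \<le> vsize (eval s1 (Var 5)) + 2 * poly pc (vsize (eval s1 (Var 5))) \<and> s' = s1(6 :=
          y)" for s'
    proof -
      from that obtain y where y: "vsize y \<le> vsize (wem_val k (inst d)) + 2 * poly pc (vsize (wem_val k
          (inst d)))"
        "s' = s1(6 := y)" by (auto simp: s1_def)
      then have "vsize y \<le> L" using szw pcJ unfolding L_def by linarith
      with y(2) show ?thesis by blast
    qed
  qed (use szw pcJ in \<open>auto simp: s1_def\<close>)
  let ?tail = "Seq (Call 5 ca (MkNode ?e (Var 6)))
    (Seq (Cond (IsNode (Var 5)) (Assign 0 (Var 5)) (Assign 5 (Const 0))) (Assign 4 (Right (Var 4))))"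
  let ?T = "(40 + 40 * Z + 2 * L + 2 * H) + ((20 + 2 * H) + (3 + 2 * Z))"
  have 3: "\<exists>s'. det_exec ?tail (s1(6 := y)) s' ?T \<and> s' 1 = x \<and> s' 3 = ps \<and> s' 4 = rest \<and> s' 0 = upd y"
    if y: "vsize y \<le> L" for y
  proof -
    let ?s2 = "s1(6 := y)"
    let ?a = "attempt k (Node (inst d) y)"
    define s3 where "s3 = ?s2(5 := ?a)"
    have s2: "?s2 1 = x" "?s2 3 = ps" "?s2 4 = Node (Num d) rest" "?s2 6 = y"
      using s by (simp_all add: s1_def)
    have szy: "vsize (Node (inst d) y) \<le> 3 + 3 * Z + L" using szi y by simp
    have pH: "poly p2 (vsize (Node (inst d) y)) \<le> H" unfolding H_def by (rule poly_nat_mono[OF szy])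
    have sza: "vsize ?a \<le> H" using ca pH unfolding computes_def by (meson le_trans)
    have 31: "det_exec (Call 5 ca (MkNode ?e (Var 6))) ?s2 s3 (40 + 40 * Z + 2 * L + 2 * H)"
    proof (rule det_exec_mono)
      have ev: "eval ?s2 (MkNode ?e (Var 6)) = Node (inst d) y"
        using eval_e[OF s2(1,2,3)] by simp
      show "det_exec (Call 5 ca (MkNode ?e (Var 6))) ?s2 s3
          (1 + cost ?s2 (MkNode ?e (Var 6)) + 2 * poly p2 (vsize (Node (inst d) y)))"
        using det_exec_Call[OF ca, of 5 "MkNode ?e (Var 6)" ?s2] unfolding ev s3_def .
      have "cost ?s2 (MkNode ?e (Var 6)) = 1 + vsize (Node (inst d) y) + cost ?s2 ?e + (1 + vsize y)"
        using ev s2(4) by (simp only: cost.simps(1,3) eval.simps(1))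
      then show "1 + cost ?s2 (MkNode ?e (Var 6)) + 2 * poly p2 (vsize (Node (inst d) y)) \<le> 40 +
          40 * Z + 2 * L + 2 * H"
        using cost_e[OF s2(1,2,3)] szy y pH by linarith
    qed
    have "\<exists>s4. det_exec (Cond (IsNode (Var 5)) (Assign 0 (Var 5)) (Assign 5 (Const 0))) s3 s4 (20 + 2 * H) \<and>
      s4 1 = x \<and> s4 3 = ps \<and> s4 4 = Node (Num d) rest \<and> s4 0 = upd y"
    proof (cases "is_node ?a")
      case True
      then have "truth (eval s3 (IsNode (Var 5)))" by (simp add: s3_def)
      from det_exec_CondTrue[OF this det_exec_Assign[of 0 "Var 5"], of "Assign 5 (Const 0)"] sza True s2
          vsize_of_truth[of True] show ?thesis
        by (intro exI[of _ "s3(0 := ?a)"] conjI)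
          (auto simp: s3_def upd_def elim!: det_exec_mono)
    next
      case False
      then have "\<not> truth (eval s3 (IsNode (Var 5)))" by (simp add: s3_def)
      from det_exec_CondFalse[OF this det_exec_Assign[of 5 "Const 0"], of "Assign 0 (Var 5)"] sza False
          s s2 vsize_of_truth[of False] show ?thesis
        by (intro exI[of _ "s3(5 := Num 0)"] conjI)
          (auto simp: s3_def s1_def upd_def elim!: det_exec_mono)
    qed
    then obtain s4 where 32: "det_exec (Cond (IsNode (Var 5)) (Assign 0 (Var 5)) (Assign 5 (Const 0)))
        s3 s4 (20 + 2 * H)"
      and s4: "s4 1 = x" "s4 3 = ps" "s4 4 = Node (Num d) rest" "s4 0 = upd y" by blast
    have 33: "det_exec (Assign 4 (Right (Var 4))) s4 (s4(4 := rest)) (3 + 2 * Z)"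
      using det_exec_Assign[of 4 "Right (Var 4)" s4]
      by (auto elim!: det_exec_mono simp: s4 simp del: vsize.simps) (use sz in linarith)
    from det_exec_Seq[OF 31 det_exec_Seq[OF 32 33]] s4 show ?thesis
      by (intro exI[of _ "s4(4 := rest)"]) simp
  qed
  have "run ?tail s' ?T (\<lambda>s''. s'' 1 = x \<and> s'' 3 = ps \<and> s'' 4 = rest \<and> s'' 0 = upd y) (\<lambda>_. True)"
    if "vsize y \<le> L" "s' = s1(6 := y)" for s' :: state and y
    using 3[OF that(1)] that(2) by (auto intro: run_det)
  note tail = this
  have "run (Seq (Call 6 c (Var 5)) ?tail) s1 (3 + 2 * J + 3 * poly pc J + ?T)
    (\<lambda>s'. s' 1 = x \<and> s' 3 = ps \<and> s' 4 = rest \<and> (\<exists>y. s' 0 = upd y)) (\<lambda>s'. \<exists>y\<in>wem_answers (G d). s' 0 =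
        upd y)"
  proof (rule run_weaken[OF _ le_refl])
    let ?Q = "\<lambda>s'. s' 1 = x \<and> s' 3 = ps \<and> s' 4 = rest \<and> (\<exists>y. s' 0 = upd y)"
    show "run (Seq (Call 6 c (Var 5)) ?tail) s1 (3 + 2 * J + 3 * poly pc J + ?T) ?Q
      (\<lambda>s'. \<exists>y\<in>wem_answers (G d). s' 0 = upd y)"
    proof (rule run_Seq_first[OF 2, where R' = "\<lambda>_. True"])
      fix s' :: state assume s': "\<exists>y. vsize y \<le> L \<and> s' = s1(6 := y)"
      then obtain y where y: "vsize y \<le> L" "s' = s1(6 := y)" by blast
      show "run ?tail s' ?T ?Q (\<lambda>_. True)"
        using tail[OF y] by (rule run_weaken) auto
      assume "\<exists>y\<in>wem_answers (G d). s' = s1(6 := y)"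
      then obtain y' where y': "y' \<in> wem_answers (G d)" "s' = s1(6 := y')" by blast
      \<comment> \<open>Both are the content of variable 6.\<close>
      then have "y' = y" using y(2) by (metis fun_upd_same)
      then show "run ?tail s' ?T (\<lambda>s'. \<exists>y\<in>wem_answers (G d). s' 0 = upd y) (\<lambda>_. True)"
        using tail[OF y] y' by - (erule run_weaken, auto)
    qed
  qed auto
  from run_Seq_det[OF 1 this] show ?thesis
    by (simp only: search_body_def body_time_def Let_def J_def[symmetric] L_def[symmetric]
        H_def[symmetric] upd_def)
qed

text \<open>Both lists are shorter than the encoding. With \<open>D\<close> polynomial in its
  length, the paddings and the number of rounds become polynomial.\<close>

lemma N_le:
  assumes "\<And>t c. t \<in> T \<Longrightarrow> c \<in> C \<Longrightarrow> distance I t c \<le> D"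
  shows "N \<le> vsize x * (vsize x * D)"
proof -
  have "N \<le> (\<Sum>t\<in>T. \<Sum>c\<in>C. D)" unfolding N_eq by (intro sum_mono assms)
  also have "\<dots> = length ts * (length cs * D)"
    using distinct_card[OF ts(1)] distinct_card[OF cs(1)] ts(2) cs(2) by simp
  also have "\<dots> \<le> vsize x * (vsize x * D)"
    using length_less_vsize[of ts "\<lambda>t. enc_triple (t, tlevel I 1 t, tlevel I 2 t)"]
      length_less_vsize[of cs "\<lambda>c. enc_triple (c, clevel I 1 c, clevel I 2 c)"]
    by (intro mult_le_mono le_refl) (simp_all add: x)
  finally show ?thesis .
qed

text \<open>\<open>M\<close> bounds the number of paddings and costs, \<open>Z\<close> the sizes of
  the instance and of the padding list; both are later chosen as functions of the encoding length
  alone.\<close>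

lemma run_search:
  assumes ct: "computes ct (\<lambda>x. Num (1 + total_dist x)) p0"
    and ci: "computes ci (wem_val k) p1" and c: "solves c pc (WEM (weight_bound k))"
    and ca: "computes ca (attempt k) p2"
    and M: "Suc N \<le> M"
    and Z: "vsize x + M * (M + 3) + 1 \<le> Z"
  shows "run (search ct ci c ca) (init x)
    ((40 + 10 * Z + 2 * poly p0 (vsize x) + Suc M * (30 + 10 * M + 5 * (M * (M + 3)))) +
      Suc M * (body_time p1 pc p2 Z + Z + 5))
    (\<lambda>_. True) (\<lambda>s. s 0 \<in> bm_answers I)"
proof -
  let ?s = "(init x)(1 := x, 2 := Num (Suc N), 3 := ps, 4 := ps, 0 := Num 0)"
  have ps_eq: "ps = enc_list Num (rev [0..<Suc N])" by (simp add: ps_def pads_def)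
  have NM: "Suc N * (Suc N + 3) \<le> M * (M + 3)" using M by (intro mult_le_mono add_mono) auto
  have szps: "vsize ps \<le> Z" "vsize x \<le> Z"
    using vsize_countdown[of "Suc N"] NM Z unfolding ps_eq by linarith+
  have 1: "det_exec (search_prefix ct) (init x) ?s
    (40 + 10 * Z + 2 * poly p0 (vsize x) + Suc M * (30 + 10 * M + 5 * (M * (M + 3))))"
  proof -
    let ?s1 = "(init x)(1 := x)"
    let ?s2 = "?s1(2 := Num (Suc N))"
    let ?s4 = "?s2(3 := Num 0, 4 := Num 0)"
    let ?s5 = "?s4(3 := ps, 4 := Num (Suc N))"
    have a: "det_exec (Assign 1 (Var 0)) (init x) ?s1 (2 + vsize x)"
      using det_exec_Assign[of 1 "Var 0" "init x"] by (simp add: init_def)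
    have b: "det_exec (Call 2 ct (Var 0)) ?s1 ?s2 (2 + vsize x + 2 * poly p0 (vsize x))"
      using det_exec_Call[OF ct, of 2 "Var 0" ?s1] by (simp add: init_def total_dist_x)
    have c: "det_exec (Assign 3 (Const 0)) ?s2 (?s2(3 := Num 0)) 3"
      by (rule det_exec_mono[OF det_exec_Assign[of 3 "Const 0" ?s2, unfolded eval.simps]]) simp
    have d: "det_exec (Assign 4 (Const 0)) (?s2(3 := Num 0)) ?s4 3"
      by (rule det_exec_mono[OF det_exec_Assign[of 4 "Const 0" "?s2(3 := Num 0)",
          unfolded eval.simps]]) simp
    have "det_exec pad_loop ?s4 (?s4(3 := enc_list Num (rev [0..<Suc N]), 4 := Num (Suc N)))
      (Suc (Suc N - 0) * (30 + 10 * Suc N + 5 * (Suc N * (Suc N + 3))))"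
      by (rule det_exec_pad_loop) auto
    then have e: "det_exec pad_loop ?s4 ?s5 (Suc M * (30 + 10 * M + 5 * (M * (M + 3))))"
      unfolding ps_eq
      by (rule det_exec_mono) (rule mult_le_mono, use M in simp, intro add_mono mult_le_mono le_refl,
          use M in auto)
    have f: "det_exec (Assign 4 (Var 3)) ?s5 (?s5(4 := ps)) (2 + vsize ps)"
      using det_exec_Assign[of 4 "Var 3" ?s5] by simp
    have g: "det_exec (Assign 0 (Const 0)) (?s5(4 := ps)) (?s5(4 := ps, 0 := Num 0)) 3"
      by (rule det_exec_mono[OF det_exec_Assign[of 0 "Const 0" "?s5(4 := ps)", unfolded eval.simps]]) simp
    have "?s5(4 := ps, 0 := Num 0) = ?s" by (simp add: fun_eq_iff)
    with det_exec_Seq[OF a det_exec_Seq[OF b det_exec_Seq[OF c det_exec_Seq[OF d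
       det_exec_Seq[OF e det_exec_Seq[OF f g]]]]]]
    show ?thesis unfolding search_prefix_def
      by (auto elim!: det_exec_mono) (use szps in linarith)
  qed
  define upd where "upd d r y = (if is_node (attempt k (Node (inst d) y)) then attempt k (Node (inst d)
      y) else r)" for d r y
  note body = run_search_body[OF ci c ca szps(2,1), folded upd_def]
  let ?W = "While (IsNode (Var 4)) (search_body ci c ca)"
  have s: "?s 1 = x" "?s 3 = ps" "?s 4 = enc_list Num (rev [0..<Suc N])" "vsize (?s 4) \<le> Z"
    using szps by (simp_all add: ps_def pads_def)
  have attempt: "\<exists>m. bm_feasible I m \<and> bm_cost I m = d \<and>
      attempt k (Node (inst d) y) = enc_some (enc_list (\<lambda>t. enc_pair (t, m t)) ts)"
    if "upd d r y \<noteq> r" "d < Suc N" for d r y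
    using attempt_cases[of d y] that by (auto simp: upd_def split: if_splits)
  have 2: "run ?W ?s (Suc (Suc N) * (body_time p1 pc p2 Z + Z + 5)) (\<lambda>_. True) (\<lambda>s. s 0 \<in> bm_answers I)"
  proof (cases "\<exists>m. bm_feasible I m")
    case False
    \<comment> \<open>Nothing is ever verified, and the initial \<open>Num 0\<close> is
      \<open>enc_none\<close>, so infeasibility is reported with certainty.\<close>
    then have "upd d r y = r" if "d < Suc N" for d r y using attempt that by blast
    from run_loop_idle[where upd = upd and M = "Suc N", OF body le_refl this s]
    have "run ?W ?s (Suc (Suc N) * (body_time p1 pc p2 Z + Z + 5)) (\<lambda>s. s 0 = ?s 0) (\<lambda>_. True)" .
    then have "run ?W ?s (Suc (Suc N) * (body_time p1 pc p2 Z + Z + 5)) (\<lambda>s. s 0 =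
        ?s 0) (\<lambda>s. s 0 \<in> bm_answers I)"
      by (rule run_sure) (use False in \<open>simp add: bm_answers_def\<close>)
    then show ?thesis by (rule run_weaken) auto
  next
    case True
    \<comment> \<open>The optimal cost, which is the round that has to succeed.\<close>
    define e where "e = (LEAST d. \<exists>m. bm_feasible I m \<and> bm_cost I m = d)"
    have "\<exists>m. bm_feasible I m \<and> bm_cost I m = e"
      unfolding e_def by (rule LeastI_ex) (use True in blast)
    then obtain m where m: "bm_feasible I m" "bm_cost I m = e" by blast
    have least: "e \<le> bm_cost I m'" if "bm_feasible I m'" for m'
      unfolding e_def using that by (intro Least_le) blast
    have e: "e < Suc N" using cost_le_N[of m] m by (auto simp: bm_feasible_def)
    show ?thesis
    proof (rule run_loop_success[where upd = upd and M = "Suc N", OF body le_refl e _ _ s])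
      \<comment> \<open>A verified \<open>d\<close> is the cost of a feasible map, so
        \<open>d < e\<close> would contradict minimality.\<close>
      show "upd d r y = r" if "d < e" for d r y
        using attempt[of d r y] least that e by fastforce
      show "upd e r y \<in> bm_answers I" if "y \<in> wem_answers (G e)" for r y
      proof -
        from feasible_imp_exact_matching[OF m(1)] m(2) obtain M where "exact_matching (G e) M" by blast
        from attempt_success[OF that this] have node: "is_node (attempt k (Node (inst e) y))" .
        from attempt_cases[OF _ this] e obtain m' where m': "bm_feasible I m'" "bm_cost I m' = e"
          "attempt k (Node (inst e) y) = enc_some (enc_list (\<lambda>t. enc_pair (t, m' t)) ts)" by auto
        then have "bm_optimal I m'" using least by (auto simp: bm_optimal_def)
        from bm_answers_enc[OF this] show ?thesis by (simp add: upd_def node m'(3))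
      qed
    qed
  qed
  have "run ?W ?s (Suc M * (body_time p1 pc p2 Z + Z + 5)) (\<lambda>_. True) (\<lambda>s. s 0 \<in> bm_answers I)"
    by (rule run_weaken[OF 2 mult_le_mono1]) (use M in simp_all)
  from run_Seq_det[OF 1 this] show ?thesis unfolding search_def .
qed

end

text \<open>The search program tosses coins only inside \<open>c\<close>; the implication on
  \<open>flip_free\<close> makes this one construction yield both claims of the theorem.\<close>

lemma solves_BM':
  assumes c: "solves c pc (WEM (weight_bound k))"
  shows "\<exists>c' p. (flip_free c \<longrightarrow> flip_free c') \<and> solves c' p (BM' k \<pi>)"
proof -
  have "ptime (\<lambda>x. Num (1 + total_dist x))" by (intro ptime_add ptime_Num_const ptime_total_dist ptime_id)
  with ptime_wem_val[of k] ptime_attempt[of k] obtain ct p0 ci p1 ca p2 where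
    ct: "computes ct (\<lambda>x. Num (1 + total_dist x)) p0" and ci: "computes ci (wem_val k) p1"
    and ca: "computes ca (attempt k) p2"
    unfolding ptime_def by blast
  \<comment> \<open>\<open>M\<close> bounds \<open>N + 1\<close> by \<open>N_le\<close>, and
    \<open>Z\<close> leaves room for the padding list by \<open>vsize_countdown\<close>.\<close>
  define M where "M n = 1 + n * (n * poly \<pi> n)" for n
  define Z where "Z n = n + M n * (M n + 3) + 1" for n
  define S where "S n = (40 + 10 * Z n + 2 * poly p0 n + (1 + M n) * (30 + 10 * M n + 5 * (M n * (M n +
      3)))) +
      (1 + M n) * (body_time p1 pc p2 (Z n) + Z n + 5)" for n
  have "poly_bounded S" unfolding S_def Z_def M_def
    by (intro poly_bounded_intros poly_bounded_body_time)
  then obtain p where p: "\<And>n. S n \<le> poly p n" unfolding poly_bounded_def by blast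
  have "solves (search ct ci c ca) p (BM' k \<pi>)"
    unfolding solves_def
  proof (clarify)
    fix x Y assume "(x, Y) \<in> BM' k \<pi>"
    then obtain I where I: "Y = bm_answers I" "bm_wf I" "nlevels I 2 = k" "bm_encodes I x"
      "\<And>t c. t \<in> treatments I \<Longrightarrow> c \<in> controls I \<Longrightarrow> distance I t c \<le> poly \<pi> (vsize x)"
      unfolding BM'_def by blast
    from I(4) obtain ts cs where enc: "enumerates id ts (treatments I)" "enumerates id cs (controls I)"
      "x = Node (enc_pair (nlevels I 1, nlevels I 2))
          (Node (enc_list (\<lambda>t. enc_triple (t, tlevel I 1 t, tlevel I 2 t)) ts)
            (Node (enc_list (\<lambda>c. enc_triple (c, clevel I 1 c, clevel I 2 c)) cs)
              (enc_list (\<lambda>t. enc_list (\<lambda>c. Num (distance I t c)) cs) ts)))"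
      unfolding bm_encodes_def by blast
    interpret bm_input I ts cs k x
      by unfold_locales (use I enc in \<open>simp_all add: enumerates_def\<close>)
    have "Suc N \<le> M (vsize x)" unfolding M_def using N_le[OF I(5)] by simp
    from run_search[OF ct ci c ca this, of "Z (vsize x)"]
    have "run (search ct ci c ca) (init x) (S (vsize x)) (\<lambda>_. True) (\<lambda>s. s 0 \<in> Y)"
      by (simp add: Z_def S_def I(1))
    then obtain \<mu> where \<mu>: "exec (search ct ci c ca) (init x) \<mu>"
      "\<And>s t. (s, t) \<in> set_pmf \<mu> \<Longrightarrow> t \<le> S (vsize x)" "measure_pmf.prob \<mu> {(s, t). s 0 \<in> Y} \<ge> 2 / 3"
      unfolding run_def by blast
    have "(\<lambda>(s, t). (s 0, t)) -` {(y, t). y \<in> Y} = {(s :: state, t :: nat). s 0 \<in> Y}" by auto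
    with \<mu>(3) have "measure_pmf.prob (map_pmf (\<lambda>(s, t). (s 0, t)) \<mu>) {(y, t). y \<in> Y} \<ge> 2 / 3"
      unfolding measure_map_pmf by (simp only:)
    moreover have "t \<le> poly p (vsize x)" if "(y, t) \<in> set_pmf (map_pmf (\<lambda>(s, t). (s 0, t)) \<mu>)" for y t
      using that \<mu>(2) p[of "vsize x"] by (auto intro: le_trans)
    ultimately show "\<exists>\<rho>. runs (search ct ci c ca) x \<rho> \<and> (\<forall>(y, t) \<in> set_pmf \<rho>. t \<le> poly p (vsize x)) \<and>
        measure_pmf.prob \<rho> {(y, t). y \<in> Y} \<ge> 2 / 3"
      unfolding runs_def using \<mu>(1) by blast
  qed
  moreover have "flip_free c \<longrightarrow> flip_free (search ct ci c ca)"
    using ct ci ca by (simp add: computes_def search_def search_prefix_def search_body_def pad_loop_def)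
  ultimately show ?thesis by blast
qed

theorem theorem4p5:
  "((\<forall>q. det_poly_time (WEM q)) \<longrightarrow> (\<forall>k2 \<pi>. det_poly_time (BM' k2 \<pi>))) \<and>
   ((\<forall>q. rand_poly_time (WEM q)) \<longrightarrow> (\<forall>k2 \<pi>. rand_poly_time (BM' k2 \<pi>)))"
  unfolding det_poly_time_iff rand_poly_time_iff using solves_BM' by meson

end
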